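(* Let $r_1,r_2>0$ and let $f(x_1,x_2)=\sum_{k_1,k_2=0}^\infty b_{k_1,k_2}x_1^{k_1}x_2^{k_2}$ be a holomorphic function in $B_{r_1}(0)\times B_{r_2}(0)$. Let $\theta,\vartheta$ be random variables (defined jointly) with values in $S^1$, put $\alpha_{k_1,k_2}:=\mathbb{E}[\theta^{k_1}\vartheta^{k_2}]$, and let $$\Omega':=\{(x_1,x_2)\in\mathbb{C}^2:\ |x_i|\le 1\text{ if }r_i>1\text{ and }|x_i|<r_i\text{ if }r_i\le 1\}.$$ Then for all $(x_1,x_2)\in\Omega'$ and all $n$, $$\mathbb{E}_n\left[W^1(f)(x_1,x_2)\right]=\left[\prod_{k_1,k_2=0}^\infty(1-x_1^{k_1}x_2^{k_2}t)^{-\alpha_{k_1,k_2}b_{k_1,k_2}}\right]_n,$$ $$\mathbb{E}_n\left[W^2(f)(x_1,x_2)\right]=\left[\prod_{k_1,k_2=0}^\infty(1-\alpha_{k_1,k_2}x_1^{k_1}x_2^{k_2}t)^{-b_{k_1,k_2}}\right]_n.$$ The products are holomorphic in $(x_1,x_2,t)$ in the interior of $\Omega'\times B_1(0)$, and they are holomorphic in $t$ in $B_1(0)$ for all $(x_1,x_2)\in\Omega'$.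
   Context: $B_r(x_0)=\{x\in\mathbb{C}:|x-x_0|<r\}$. $\mathcal{S}_n$ is the group of permutations of $\{1,\dots,n\}$; $\mathcal{C}_\lambda\subset\mathcal{S}_n$ is the set of permutations with cycle-type the partition $\lambda=(\lambda_1,\dots,\lambda_{l(\lambda)})$ of $n$ (the $\lambda_m\geq 1$ are the cycle lengths, $l(\lambda)$ is the number of cycles). For a power series $h(t)=\sum_n h_nt^n$ write $[h(t)]_n:=h_n$. Complex powers $z^s$ are defined with the principal branch of the logarithm on $\mathbb{C}\setminus\mathbb{R}_{\le 0}$. First randomized class function: for $g\in\mathcal{C}_\lambda$, $W^1(f)(x_1,x_2)(g):=\prod_{m=1}^{l(\lambda)}f(\theta_mx_1^{\lambda_m},\vartheta_mx_2^{\lambda_m})$, where the pairs $(\theta_m,\vartheta_m)$ are iid, distributed as $(\theta,\vartheta)$, and independent of $g$ (one pair per cycle). Second randomized class function: for $g\in\mathcal{C}_\lambda$, $W^2(f)(x_1,x_2)(g):=\prod_{m=1}^{l(\lambda)}f\big(x_1^{\lambda_m}\prod_{i=1}^{\lambda_m}\theta_i^{(m)},\,x_2^{\lambda_m}\prod_{i=1}^{\lambda_m}\vartheta_i^{(m)}\big)$, where the $n$ pairs $(\theta_i^{(m)},\vartheta_i^{(m)})$ are iid, distributed as $(\theta,\vartheta)$, and independent of $g$ (one pair per point). $\mathbb{E}_n[\cdot]$ denotes expectation over $g$ uniformly distributed on $\mathcal{S}_n$ and over the auxiliary random variables. *)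

theory Defs
  imports
    "HOL-Probability.Probability"
    "HOL-Complex_Analysis.Complex_Analysis"
    "HOL-Combinatorics.Orbits"
begin

text \<open>Complex differentiability in several variables; meant for open \<open>U\<close>.\<close>

definition holomorphic_several :: "(complex ^ 'n \<Rightarrow> complex) \<Rightarrow> (complex ^ 'n) set \<Rightarrow> bool" where
  "holomorphic_several F U \<longleftrightarrow>
     (\<forall>z\<in>U. \<exists>D. (F has_derivative D) (at z) \<and> (\<forall>c v. D (c *s v) = c * D v))"

text \<open>Unordered infinite products: convergence of the net of finite partial products, with the
  usual requirement that the limit be nonzero (all products below have nonzero factors).\<close>

definition has_infprod :: "('i \<Rightarrow> complex) \<Rightarrow> complex \<Rightarrow> 'i set \<Rightarrow> bool" where
  "has_infprod g P A \<longleftrightarrow> P \<noteq> 0 \<and> ((\<lambda>F. \<Prod>k\<in>F. g k) \<longlongrightarrow> P) (finite_subsets_at_top A)"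

definition infprod_convergent :: "('i \<Rightarrow> complex) \<Rightarrow> 'i set \<Rightarrow> bool" where
  "infprod_convergent g A \<longleftrightarrow> (\<exists>P. has_infprod g P A)"

definition infprod :: "('i \<Rightarrow> complex) \<Rightarrow> 'i set \<Rightarrow> complex" where
  "infprod g A = Lim (finite_subsets_at_top A) (\<lambda>F. \<Prod>k\<in>F. g k)"

text \<open>The cycle type of a permutation \<open>g\<close> of \<open>{1..n}\<close> as a weakly decreasing list; fixed points
  contribute parts equal to 1.\<close>

definition cycle_type :: "nat \<Rightarrow> (nat \<Rightarrow> nat) \<Rightarrow> nat list" where
  "cycle_type n g =
     rev (sorted_list_of_multiset (image_mset card (mset_set (orbit g ` {1..n}))))"

text \<open>The cycle index \<open>m\<close> and the index \<open>i\<close> inside a cycle start at 0 here.\<close>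

definition W1 :: "(complex \<Rightarrow> complex \<Rightarrow> complex) \<Rightarrow> complex \<Rightarrow> complex \<Rightarrow> nat
    \<Rightarrow> (nat \<Rightarrow> complex \<times> complex) \<Rightarrow> (nat \<Rightarrow> nat) \<Rightarrow> complex" where
  "W1 f x1 x2 n \<Theta> g = (let ls = cycle_type n g in
     \<Prod>m<length ls. f (fst (\<Theta> m) * x1 ^ (ls ! m)) (snd (\<Theta> m) * x2 ^ (ls ! m)))"

definition W2 :: "(complex \<Rightarrow> complex \<Rightarrow> complex) \<Rightarrow> complex \<Rightarrow> complex \<Rightarrow> nat
    \<Rightarrow> (nat \<times> nat \<Rightarrow> complex \<times> complex) \<Rightarrow> (nat \<Rightarrow> nat) \<Rightarrow> complex" where
  "W2 f x1 x2 n \<Theta> g = (let ls = cycle_type n g in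
     \<Prod>m<length ls. f (x1 ^ (ls ! m) * (\<Prod>i<ls ! m. fst (\<Theta> (m, i))))
                       (x2 ^ (ls ! m) * (\<Prod>i<ls ! m. snd (\<Theta> (m, i)))))"

text \<open>The Borel space on \<open>S\<^sup>1 \<times> S\<^sup>1\<close>. Restricting the space makes the auxiliary variables take
  values in \<open>S\<^sup>1\<close> everywhere, not just almost surely.\<close>

definition circle_pairs :: "(complex \<times> complex) measure" where
  "circle_pairs = restrict_space borel (sphere 0 1 \<times> sphere 0 1)"

text \<open>On the probability space \<open>N\<close>, \<open>G\<close> is a uniform random permutation of \<open>{1..n}\<close> and the family
  \<open>\<Theta>\<close> over \<open>I\<close> is iid with common law \<open>L\<close> and (as a family) independent of \<open>G\<close>. The last two
  sigma-algebras are those generated by \<open>G\<close> and by \<open>(\<Theta> i)\<close> for \<open>i\<close> in \<open>I\<close>. The index set \<open>I\<close> may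
  be larger than what a particular permutation uses: \<open>W1\<close> only evaluates one index per cycle, and
  \<open>W2\<close> only the \<open>n\<close> pairs \<open>(m, i)\<close> with \<open>i\<close> below the length of cycle \<open>m\<close>.\<close>

definition uniform_perm_with_iid :: "(complex \<times> complex) measure \<Rightarrow> nat \<Rightarrow> 'i set
    \<Rightarrow> 'v measure \<Rightarrow> ('v \<Rightarrow> nat \<Rightarrow> nat) \<Rightarrow> ('i \<Rightarrow> 'v \<Rightarrow> complex \<times> complex) \<Rightarrow> bool" where
  "uniform_perm_with_iid L n I N G \<Theta> \<longleftrightarrow>
     prob_space N \<and>
     G \<in> measurable N (count_space {p. p permutes {1..n}}) \<and>
     distr N (count_space {p. p permutes {1..n}}) G = uniform_count_measure {p. p permutes {1..n}} \<and>
     prob_space.indep_vars N (\<lambda>_. circle_pairs) \<Theta> I \<and>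
     (\<forall>i\<in>I. distr N circle_pairs (\<Theta> i) = L) \<and>
     prob_space.indep_set N
       (sets (vimage_algebra (space N) G (count_space {p. p permutes {1..n}})))
       (sets (vimage_algebra (space N) (\<lambda>\<omega>. \<lambda>i\<in>I. \<Theta> i \<omega>) (PiM I (\<lambda>_. circle_pairs))))"

definition Omega' :: "real \<Rightarrow> real \<Rightarrow> (complex \<times> complex) set" where
  "Omega' r1 r2 = {(x1, x2).
     (r1 > 1 \<longrightarrow> cmod x1 \<le> 1) \<and> (r1 \<le> 1 \<longrightarrow> cmod x1 < r1) \<and>
     (r2 > 1 \<longrightarrow> cmod x2 \<le> 1) \<and> (r2 \<le> 1 \<longrightarrow> cmod x2 < r2)}"

definition factor1 :: "(nat \<Rightarrow> nat \<Rightarrow> complex) \<Rightarrow> (nat \<Rightarrow> nat \<Rightarrow> complex)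
    \<Rightarrow> complex \<Rightarrow> complex \<Rightarrow> complex \<Rightarrow> nat \<times> nat \<Rightarrow> complex" where
  "factor1 \<alpha> b x1 x2 t = (\<lambda>(k1, k2). (1 - x1 ^ k1 * x2 ^ k2 * t) powr (- (\<alpha> k1 k2 * b k1 k2)))"

definition factor2 :: "(nat \<Rightarrow> nat \<Rightarrow> complex) \<Rightarrow> (nat \<Rightarrow> nat \<Rightarrow> complex)
    \<Rightarrow> complex \<Rightarrow> complex \<Rightarrow> complex \<Rightarrow> nat \<times> nat \<Rightarrow> complex" where
  "factor2 \<alpha> b x1 x2 t = (\<lambda>(k1, k2). (1 - \<alpha> k1 k2 * x1 ^ k1 * x2 ^ k2 * t) powr (- b k1 k2))"

end

theory Submission
  imports Defs
begin

text \<open>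
  Expanding the logarithm of a product \<open>\<Prod>k. (1 - u k * t) powr (- c k)\<close> gives the power series
  \<open>\<Sum>l\<ge>1. a l * t ^ l / l\<close>, where \<open>a l = (\<Sum>k. c k * u k ^ l)\<close> are weighted power sums. By the exponential formula for
  permutations (\<open>sum_cycle_weight\<close>) the coefficient of \<open>t ^ n\<close> in \<open>exp (\<Sum>l\<ge>1. a l * t ^ l / l)\<close> is the average, over the
  permutations \<open>g\<close> of \<open>n\<close> points, of the product of \<open>a l\<close> over the cycle lengths \<open>l\<close> of \<open>g\<close>.

  Conditionally on \<open>g\<close> the factors of the random class functions are independent, since different cycles use
  different auxiliary pairs. Integrating the series of \<open>f\<close> term by term, the expected factor of a cycle of length \<open>l\<close> is
  \<open>\<Sum>(k1, k2). b k1 k2 * x1 ^ (l * k1) * x2 ^ (l * k2) * \<alpha> k1 k2\<close> if there is one pair per cycle. This is the power sum \<open>a l\<close> for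
  \<open>c = \<alpha> k1 k2 * b k1 k2\<close> and \<open>u = x1 ^ k1 * x2 ^ k2\<close>. If there is one pair per point, independence replaces \<open>\<alpha> k1 k2\<close>
  by \<open>\<alpha> k1 k2 ^ l\<close>, which is absorbed by taking \<open>c = b k1 k2\<close> and \<open>u = \<alpha> k1 k2 * x1 ^ k1 * x2 ^ k2\<close>. The two cases are
  handled together in \<open>has_bochner_integral_random_class_function\<close>.

  The moments have modulus at most \<open>1\<close>, and the point \<open>(x1, x2)\<close> lies in the open bidisc on which the series of \<open>f\<close>
  converges absolutely as well as in the closed unit bidisc. Hence \<open>c k * u k\<close> is absolutely summable and
  \<open>cmod (u k) \<le> 1\<close>, so that the logarithmic series converges absolutely for \<open>cmod t < 1\<close>, and the product converges to its
  exponential, which is holomorphic in \<open>t\<close>. In all three variables the logarithmic series is differentiated term by term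
  (\<open>log_series_holomorphic_several\<close>).
\<close>

\<comment> \<open>The infix dollar sign is needed for the components of vectors only.\<close>
no_notation fps_nth (infixl \<open>$\<close> 75)

section \<open>The exponential formula for permutations\<close>

text \<open>Composing a permutation \<open>q\<close> of \<open>A\<close> with the transposition of a new point \<open>x\<close> and some \<open>b \<in> A\<close>
  inserts \<open>x\<close> into the cycle of \<open>b\<close>, directly before \<open>b\<close>, and leaves the other cycles alone.\<close>
lemma orbit_transpose_insert:
  assumes q: "q permutes A" "finite A" and x: "x \<notin> A" and b: "b \<in> A"
  defines "p \<equiv> Transposition.transpose x b \<circ> q"
  shows orbit_transpose_insert_root: "orbit p x = insert x (orbit q b)"
    and orbit_transpose_insert_other: "\<And>y. y \<in> A \<Longrightarrow> y \<notin> orbit q b \<Longrightarrow> orbit p y = orbit q y"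
proof -
  have p: "p permutes insert x A"
    unfolding p_def using q b permutes_subset[OF q(1), of "insert x A"]
    by (intro permutes_compose permutes_swap_id) auto
  have perm: "permutation p" "permutation q"
    using p q by (auto simp: permutation_permutes)
  have qx: "q x = x" using q x by (auto simp: permutes_def)
  have px: "p x = b" by (simp add: p_def qx)
  have py: "p y = (if q y = b then x else q y)" if "y \<in> A" for y
  proof -
    have "q y \<noteq> x" using that x permutes_in_image[OF q(1), of y] by auto
    then show ?thesis by (simp add: p_def transpose_apply_other)
  qed
  have CA: "orbit q b \<subseteq> A" using q b by (intro permutes_orbit_subset)
  have bC: "b \<in> orbit q b" using perm by (intro permutation_self_in_orbit)
  show "orbit p x = insert x (orbit q b)"
  proof (intro subset_antisym subsetI)
    fix y assume "y \<in> orbit p x"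
    then show "y \<in> insert x (orbit q b)"
    proof induct
      case base
      show ?case using bC px by simp
    next
      case (step y)
      show ?case
      proof (cases "y = x")
        case False
        then have "y \<in> orbit q b" using step by simp
        then have "q y \<in> orbit q b" "y \<in> A" using CA by (auto intro: orbit.intros)
        then show ?thesis by (simp add: py)
      qed (use bC px in simp)
    qed
  next
    fix y assume "y \<in> insert x (orbit q b)"
    moreover have "x \<in> orbit p x" using perm by (intro permutation_self_in_orbit)
    moreover have "b \<in> orbit p x" using orbit.base[of p x] px by simp
    moreover have "y \<in> orbit p x" if "y \<in> orbit q b"
      using that
    proof induct
      case base
      show ?case using orbit.step[OF \<open>b \<in> orbit p x\<close>] py[OF b] \<open>b \<in> orbit p x\<close> by (auto split: if_splits)
    next
      case (step y)
      then show ?case using orbit.step[OF step(2)] py[of y] CA \<open>b \<in> orbit p x\<close> by (auto split: if_splits)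
    qed
    ultimately show "y \<in> orbit p x" by auto
  qed
  show "orbit p y = orbit q y" if y: "y \<in> A" "y \<notin> orbit q b" for y
  proof (rule orbit_cong0[symmetric])
    show "y \<in> orbit q y" using perm by (intro permutation_self_in_orbit)
    show "q \<in> orbit q y \<rightarrow> orbit q y" by (auto intro: orbit.intros)
    fix z assume z: "z \<in> orbit q y"
    have "b \<notin> orbit q y"
      using y orbit_swap[of y q b] perm by (auto intro: permutation_self_in_orbit)
    moreover have "q z \<in> orbit q y" using z by (rule orbit.step)
    moreover have "z \<in> A" using z permutes_orbit_subset[OF q(1) y(1)] by auto
    ultimately show "q z = p z" using py[of z] by auto
  qed
qed

text \<open>The multiplicative weight of \<open>p\<close> on \<open>A\<close> that gives a cycle of length \<open>l\<close> the factor \<open>a l\<close>.\<close>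
definition cycle_weight :: "(nat \<Rightarrow> 'b::comm_monoid_mult) \<Rightarrow> ('a \<Rightarrow> 'a) \<Rightarrow> 'a set \<Rightarrow> 'b" where
  "cycle_weight a p A = (\<Prod>C\<in>orbit p ` A. a (card C))"

text \<open>The same weight, except that the cycle through the root \<open>x\<close> is counted with its length increased
  by \<open>j\<close>. The shift \<open>j\<close> records the points already removed from that cycle when points are removed
  one after another.\<close>
definition rooted_weight :: "(nat \<Rightarrow> 'b::comm_monoid_mult) \<Rightarrow> nat \<Rightarrow> 'a \<Rightarrow> ('a \<Rightarrow> 'a) \<Rightarrow> 'a set \<Rightarrow> 'b" where
  "rooted_weight a j x p A =
     a (j + card (orbit p x)) * (\<Prod>C\<in>orbit p ` A - {orbit p x}. a (card C))"

lemma cycle_weight_eq_rooted: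
  assumes "finite A" "x \<in> A"
  shows "cycle_weight a p A = rooted_weight a 0 x p A"
  unfolding cycle_weight_def rooted_weight_def using assms
  by (subst prod.remove[of _ "orbit p x"]) auto

lemma rooted_weight_fixed:
  assumes q: "q permutes A" and x: "x \<notin> A"
  shows "rooted_weight a j x q (insert x A) = a (Suc j) * cycle_weight a q A"
proof -
  have "q x = x" using q x by (auto simp: permutes_def)
  then have "orbit q x = {x}" by (simp add: orbit_eq_singleton_iff)
  moreover have "{x} \<notin> orbit q ` A"
    using permutes_orbit_subset[OF q] x by blast
  ultimately show ?thesis by (simp add: rooted_weight_def cycle_weight_def)
qed

lemma rooted_weight_transpose:
  assumes q: "q permutes A" "finite A" and x: "x \<notin> A" and b: "b \<in> A"
  shows "rooted_weight a j x (Transposition.transpose x b \<circ> q) (insert x A) = rooted_weight a (Suc j) b q A"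
proof -
  define p where "p = Transposition.transpose x b \<circ> q"
  note root = orbit_transpose_insert_root[OF q x b, folded p_def]
  note other = orbit_transpose_insert_other[OF q x b, folded p_def]
  have "p permutes insert x A"
    unfolding p_def using q b permutes_subset[OF q(1), of "insert x A"]
    by (intro permutes_compose permutes_swap_id) auto
  then have perm: "permutation p" "permutation q"
    using q by (auto simp: permutation_permutes)
  have self: "\<And>y. y \<in> orbit q y" "\<And>y. y \<in> orbit p y"
    using perm by (auto intro: permutation_self_in_orbit)
  have CA: "orbit q y \<subseteq> A" if "y \<in> A" for y using q that by (intro permutes_orbit_subset)
  have "card (orbit p x) = Suc (card (orbit q b))"
    using root CA[OF b] x q(2) finite_subset by (subst root) (auto intro!: card_insert_disjoint)
  moreover have "orbit p ` insert x A - {orbit p x} = orbit q ` A - {orbit q b}"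
  proof (intro subset_antisym subsetI)
    fix C assume "C \<in> orbit p ` insert x A - {orbit p x}"
    then obtain y where y: "y \<in> A" "C = orbit p y" "orbit p y \<noteq> orbit p x" by auto
    have "y \<notin> orbit q b"
    proof
      assume "y \<in> orbit q b"
      then have "y \<in> orbit p x" by (simp add: root)
      then have "orbit p y = orbit p x"
        using self perm by (metis cyclic_on_orbit' orbit_cyclic_eq3)
      with y show False by simp
    qed
    with other[OF y(1)] y self show "C \<in> orbit q ` A - {orbit q b}" by auto
  next
    fix C assume "C \<in> orbit q ` A - {orbit q b}"
    then obtain y where y: "y \<in> A" "C = orbit q y" "orbit q y \<noteq> orbit q b" by auto
    have "y \<notin> orbit q b"
      using y perm by (metis cyclic_on_orbit' orbit_cyclic_eq3)
    from other[OF y(1) this] y CA[OF y(1)] x self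
    show "C \<in> orbit p ` insert x A - {orbit p x}" by auto
  qed
  ultimately show ?thesis by (simp add: rooted_weight_def p_def)
qed

lemma sum_rooted_weight_insert:
  fixes a :: "nat \<Rightarrow> 'b::comm_semiring_1"
  assumes A: "finite A" and x: "x \<notin> A"
  shows "(\<Sum>p | p permutes insert x A. rooted_weight a j x p (insert x A)) =
     a (Suc j) * (\<Sum>p | p permutes A. cycle_weight a p A) +
     (\<Sum>b\<in>A. \<Sum>p | p permutes A. rooted_weight a (Suc j) b p A)"
proof -
  have "(\<Sum>p | p permutes insert x A. rooted_weight a j x p (insert x A)) =
    (\<Sum>b\<in>insert x A. \<Sum>q | q permutes A. rooted_weight a j x (Transposition.transpose x b \<circ> q) (insert x A))"
    using A x by (rule sum_over_permutations_insert)
  also have "\<dots> = (\<Sum>q | q permutes A. rooted_weight a j x q (insert x A)) +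
    (\<Sum>b\<in>A. \<Sum>q | q permutes A. rooted_weight a j x (Transposition.transpose x b \<circ> q) (insert x A))"
    using A x by simp
  finally show ?thesis
    using A x by (simp add: rooted_weight_fixed rooted_weight_transpose sum_distrib_left)
qed

text \<open>The exponential formula for permutations: \<open>e\<close> is the coefficient sequence of
  \<open>exp (\<Sum>l\<ge>1. a l * t ^ l / l)\<close>, described by the recursion that the differential equation of the
  exponential gives. The rooted sums over a set of \<open>n\<close> points and a root satisfy
  \<open>T j n = a (j + 1) * Q n + n * T (j + 1) (n - 1)\<close>, where \<open>Q n\<close> is the unrooted sum and \<open>Q (n + 1) = T 0 n\<close>;
  both sums are evaluated in one simultaneous induction on \<open>n\<close>.\<close>
lemma sum_cycle_weight:
  fixes a e :: "nat \<Rightarrow> 'b::field_char_0" and A :: "'a set"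
  assumes e0: "e 0 = 1" and eSuc: "\<And>n. of_nat (Suc n) * e (Suc n) = (\<Sum>i\<le>n. a (Suc i) * e (n - i))"
    and A: "finite A"
  shows "(\<Sum>p | p permutes A. cycle_weight a p A) = fact (card A) * e (card A)"
proof -
  have "(\<forall>A::'a set. finite A \<longrightarrow> card A = n \<longrightarrow>
            (\<Sum>p | p permutes A. cycle_weight a p A) = fact n * e n) \<and>
        (\<forall>(A::'a set) x j. finite A \<longrightarrow> card A = n \<longrightarrow> x \<notin> A \<longrightarrow>
            (\<Sum>p | p permutes insert x A. rooted_weight a j x p (insert x A)) =
              fact n * (\<Sum>i\<le>n. a (Suc (j + i)) * e (n - i)))" for n
  proof (induction n)
    case 0
    show ?case
    proof (intro conjI allI impI)
      fix A :: "'a set" assume "finite A" "card A = 0"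
      then show "(\<Sum>p | p permutes A. cycle_weight a p A) = fact 0 * e 0"
        by (simp add: cycle_weight_def e0)
    next
      fix A :: "'a set" and x j assume "finite A" "card A = 0"
      then show "(\<Sum>p | p permutes insert x A. rooted_weight a j x p (insert x A)) =
              fact 0 * (\<Sum>i\<le>0. a (Suc (j + i)) * e (0 - i))"
        using sum_rooted_weight_insert[of A x a j] by (simp add: cycle_weight_def e0)
    qed
  next
    case (Suc n)
    have 1: "(\<Sum>p | p permutes A. cycle_weight a p A) = fact (Suc n) * e (Suc n)"
      if A: "finite A" "card A = Suc n" for A :: "'a set"
    proof -
      obtain x B where B: "A = insert x B" "x \<notin> B" "card B = n" "finite B"
        using A by (metis card_Suc_eq_finite)
      have "(\<Sum>p | p permutes A. cycle_weight a p A) =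
            (\<Sum>p | p permutes insert x B. rooted_weight a 0 x p (insert x B))"
        unfolding B(1) using B by (intro sum.cong refl cycle_weight_eq_rooted) auto
      also have "\<dots> = fact n * (of_nat (Suc n) * e (Suc n))"
        using Suc.IH B by (simp add: eSuc del: of_nat_Suc)
      finally show ?thesis by simp
    qed
    have "(\<Sum>p | p permutes insert x A. rooted_weight a j x p (insert x A)) =
            fact (Suc n) * (\<Sum>i\<le>Suc n. a (Suc (j + i)) * e (Suc n - i))"
      if A: "finite A" "card A = Suc n" "x \<notin> A" for A :: "'a set" and x j
    proof -
      have "(\<Sum>p | p permutes A. rooted_weight a (Suc j) b p A) =
            fact n * (\<Sum>i\<le>n. a (Suc (Suc j + i)) * e (n - i))" if "b \<in> A" for b
      proof -
        have "finite (A - {b})" "card (A - {b}) = n" "b \<notin> A - {b}" "insert b (A - {b}) = A"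
          using A that by auto
        then show ?thesis
          using Suc.IH[THEN conjunct2, rule_format, of "A - {b}" b "Suc j"] by simp
      qed
      then have "(\<Sum>p | p permutes insert x A. rooted_weight a j x p (insert x A)) =
        a (Suc j) * (fact (Suc n) * e (Suc n)) +
        of_nat (Suc n) * (fact n * (\<Sum>i\<le>n. a (Suc (Suc j + i)) * e (n - i)))"
        using sum_rooted_weight_insert[OF A(1,3), of a j] 1[OF A(1,2)] A(2) by simp
      also have "\<dots> = fact (Suc n) * (a (Suc j) * e (Suc n) + (\<Sum>i\<le>n. a (Suc (Suc j + i)) * e (n - i)))"
        by (simp add: algebra_simps)
      also have "a (Suc j) * e (Suc n) + (\<Sum>i\<le>n. a (Suc (Suc j + i)) * e (n - i)) =
          (\<Sum>i\<le>Suc n. a (Suc (j + i)) * e (Suc n - i))"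
        by (subst sum.atMost_Suc_shift) simp
      finally show ?thesis .
    qed
    with 1 show ?case by blast
  qed
  with A show ?thesis by blast
qed

lemma prod_cycle_type:
  assumes "g permutes {1..n}"
  shows "(\<Prod>m<length (cycle_type n g). a (cycle_type n g ! m)) = cycle_weight a g {1..n}"
proof -
  have "(\<Prod>m<length (cycle_type n g). a (cycle_type n g ! m)) = prod_list (map a (cycle_type n g))"
    by (simp add: prod.list_conv_set_nth atLeast0LessThan)
  also have "\<dots> = prod_mset (image_mset a (mset (cycle_type n g)))"
    by (simp flip: prod_mset_prod_list)
  also have "mset (cycle_type n g) = image_mset card (mset_set (orbit g ` {1..n}))"
    by (simp add: cycle_type_def)
  finally show ?thesis
    by (simp add: cycle_weight_def prod_unfold_prod_mset image_mset.compositionality o_def)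
qed

lemma length_cycle_type_le: "length (cycle_type n g) \<le> n"
  using card_image_le[of "{1..n}" "orbit g"] by (simp add: cycle_type_def flip: size_mset)

lemma cycle_type_nth_bounds:
  assumes g: "g permutes {1..n}" and m: "m < length (cycle_type n g)"
  shows "0 < cycle_type n g ! m" "cycle_type n g ! m \<le> n"
proof -
  have "cycle_type n g ! m \<in> set (cycle_type n g)" using m by simp
  also have "\<dots> = card ` orbit g ` {1..n}"
    by (simp add: cycle_type_def)
  finally obtain y where y: "y \<in> {1..n}" "cycle_type n g ! m = card (orbit g y)" by auto
  have sub: "orbit g y \<subseteq> {1..n}" using g y(1) by (rule permutes_orbit_subset)
  then have "finite (orbit g y)" by (rule finite_subset) simp
  then show "0 < cycle_type n g ! m" by (simp add: y card_gt_0_iff orbit_nonempty)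
  show "cycle_type n g ! m \<le> n" using card_mono[OF _ sub] y by simp
qed

section \<open>Infinite products of powers in the unit disc\<close>

lemma Ln_one_minus_has_sum:
  fixes w :: complex
  assumes "cmod w < 1"
  shows "((\<lambda>j. w ^ Suc j / of_nat (Suc j)) has_sum - Ln (1 - w)) UNIV"
proof (rule norm_summable_imp_has_sum)
  have "(\<lambda>n. - ((- (- w)) ^ n) / of_nat n) sums ln (1 + - w)"
    using assms by (intro Ln_series') simp
  then have "(\<lambda>n. - (- (w ^ n) / of_nat n)) sums - ln (1 - w)"
    by (intro sums_minus) simp
  then show "(\<lambda>j. w ^ Suc j / of_nat (Suc j)) sums - Ln (1 - w)"
    by (subst sums_Suc_iff) simp
  have geo: "summable (\<lambda>j. cmod w ^ Suc j)"
    using assms by (subst summable_Suc_iff) (simp add: summable_geometric)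
  have "cmod (w ^ Suc j / of_nat (Suc j)) \<le> cmod w ^ Suc j" for j
    using mult_left_mono[of 1 "real (Suc j)" "cmod w ^ Suc j"]
    by (simp add: norm_divide norm_power divide_le_eq del: of_nat_Suc power_Suc)
  then show "summable (\<lambda>j. cmod (w ^ Suc j / of_nat (Suc j)))"
    by (intro summable_comparison_test'[OF geo, of 0]) (simp only: real_norm_def abs_norm_cancel)
qed

text \<open>For a family with \<open>cmod (u i) \<le> 1\<close> and \<open>(\<Sum>i. cmod (c i * u i)) < \<infinity>\<close>, the product of the
  powers \<open>(1 - u i * t) powr (- c i)\<close> is studied in the unit disc through its logarithm. The coefficients \<open>c i\<close> themselves
  need not be summable.\<close>
context
  fixes c u :: "'i \<Rightarrow> complex"
  assumes u_le: "\<And>i. cmod (u i) \<le> 1" and summ: "(\<lambda>i. norm (c i * u i)) summable_on UNIV"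
begin

lemma power_sum_has_sum:
  "((\<lambda>i. c i * u i ^ Suc j) has_sum (\<Sum>\<^sub>\<infinity>i. c i * u i ^ Suc j)) UNIV"
proof (rule has_sum_infsum, rule abs_summable_summable, rule Infinite_Sum.abs_summable_on_comparison_test[OF summ])
  fix i
  have "cmod (u i) * cmod (u i) ^ j \<le> cmod (u i)"
    using power_le_one[of "cmod (u i)" j] u_le[of i] by (intro mult_left_le) auto
  then show "cmod (c i * u i ^ Suc j) \<le> cmod (c i * u i)"
    by (simp add: norm_mult norm_power mult_left_mono)
qed

text \<open>The double series obtained by expanding every logarithm converges absolutely, being dominated by
  \<open>cmod (c i * u i) * cmod t ^ (j + 1)\<close>; summing it in the other order gives the power series in \<open>t\<close>.\<close>
lemma log_product_has_sum:
  assumes t: "cmod t < 1"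
  shows "((\<lambda>i. - c i * Ln (1 - u i * t)) has_sum
           (\<Sum>\<^sub>\<infinity>i. - c i * Ln (1 - u i * t))) UNIV" (is "(?f has_sum ?S) _")
    and "(\<lambda>j. (\<Sum>\<^sub>\<infinity>i. c i * u i ^ Suc j) / of_nat (Suc j) * t ^ Suc j) sums
           (\<Sum>\<^sub>\<infinity>i. - c i * Ln (1 - u i * t))"
proof -
  let ?g = "\<lambda>(i, j). c i * ((u i * t) ^ Suc j / of_nat (Suc j))"
  have ut: "cmod (u i * t) < 1" for i
    using u_le[of i] t mult_mono[of "cmod (u i)" 1 "cmod t" "cmod t"] by (simp add: norm_mult)
  have "(\<lambda>(i, j). cmod (c i * u i) * cmod t ^ Suc j) summable_on UNIV \<times> UNIV"
  proof (rule summable_on_SigmaI)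
    show "((\<lambda>j. case (i, j) of (i, j) \<Rightarrow> cmod (c i * u i) * cmod t ^ Suc j) has_sum
            cmod (c i * u i) * (cmod t / (1 - cmod t))) UNIV" for i
    proof -
      have "(\<lambda>j. cmod t * cmod t ^ j) sums (cmod t * (1 / (1 - cmod t)))"
        using t by (intro sums_mult geometric_sums) simp
      then have "((\<lambda>j. cmod t ^ Suc j) has_sum (cmod t / (1 - cmod t))) UNIV"
        by (intro sums_nonneg_imp_has_sum) auto
      from has_sum_cmult_right[OF this, of "cmod (c i * u i)"] show ?thesis by (simp del: power_Suc)
    qed
    show "(\<lambda>i. cmod (c i * u i) * (cmod t / (1 - cmod t))) summable_on UNIV"
      using summ by (rule summable_on_cmult_left)
  qed auto
  then have "(\<lambda>x. norm (?g x)) summable_on UNIV \<times> UNIV"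
  proof (rule Infinite_Sum.abs_summable_on_comparison_test')
    fix x :: "'i \<times> nat"
    obtain i j where x: "x = (i, j)" by fastforce
    have "cmod (u i) ^ Suc j / real (Suc j) \<le> cmod (u i) / 1"
      using u_le[of i] power_le_one[of "cmod (u i)" j]
      by (intro frac_le) (auto simp: mult_left_le)
    then have "cmod (c i) * cmod t ^ Suc j * (cmod (u i) ^ Suc j / real (Suc j)) \<le>
               cmod (c i) * cmod t ^ Suc j * (cmod (u i) / 1)"
      by (intro mult_left_mono) auto
    then show "cmod (?g x) \<le> (case x of (i, j) \<Rightarrow> cmod (c i * u i) * cmod t ^ Suc j)"
      by (simp add: x norm_mult norm_divide norm_power power_mult_distrib mult_ac del: of_nat_Suc power_Suc)
  qed
  then have sg: "?g summable_on UNIV \<times> UNIV" by (rule abs_summable_summable)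
  then have G: "(?g has_sum infsum ?g (UNIV \<times> UNIV)) (UNIV \<times> UNIV)" by (rule has_sum_infsum)
  have "((\<lambda>j. ?g (i, j)) has_sum ?f i) UNIV" for i
    using has_sum_cmult_right[OF Ln_one_minus_has_sum[OF ut[of i]], of "c i"] by simp
  from has_sum_SigmaD[OF G this] have f: "(?f has_sum infsum ?g (UNIV \<times> UNIV)) UNIV" .
  then show 1: "(?f has_sum ?S) UNIV" using infsumI[OF f] by simp
  have S: "infsum ?g (UNIV \<times> UNIV) = ?S" using infsumI[OF f] by simp
  have "((\<lambda>i. (\<lambda>(j, i). ?g (i, j)) (j, i)) has_sum
           (\<Sum>\<^sub>\<infinity>i. c i * u i ^ Suc j) / of_nat (Suc j) * t ^ Suc j) UNIV" for j
    using has_sum_cmult_left[OF power_sum_has_sum[of j], of "t ^ Suc j / of_nat (Suc j)"]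
    by (simp add: power_mult_distrib mult_ac del: of_nat_Suc power_Suc)
  moreover have "((\<lambda>(j, i). ?g (i, j)) has_sum ?S) (UNIV \<times> UNIV)"
    using G[unfolded S] by (subst (asm) has_sum_swap) simp
  ultimately have "((\<lambda>j. (\<Sum>\<^sub>\<infinity>i. c i * u i ^ Suc j) / of_nat (Suc j) * t ^ Suc j) has_sum ?S) UNIV"
    by (rule has_sum_SigmaD[rotated])
  then show "(\<lambda>j. (\<Sum>\<^sub>\<infinity>i. c i * u i ^ Suc j) / of_nat (Suc j) * t ^ Suc j) sums ?S"
    by (rule has_sum_imp_sums)
qed

lemma product_has_infprod:
  assumes t: "cmod t < 1"
  shows "has_infprod (\<lambda>i. (1 - u i * t) powr (- c i)) (exp (\<Sum>\<^sub>\<infinity>i. - c i * Ln (1 - u i * t))) UNIV"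
proof -
  have "cmod (u i * t) < 1" for i
    using u_le[of i] t mult_mono[of "cmod (u i)" 1 "cmod t" "cmod t"] by (simp add: norm_mult)
  then have "u i * t \<noteq> 1" for i
    by (metis less_irrefl norm_one)
  then have "1 - u i * t \<noteq> 0" for i
    by simp
  then have *: "(\<lambda>F. \<Prod>i\<in>F. (1 - u i * t) powr (- c i)) = (\<lambda>F. exp (\<Sum>i\<in>F. - c i * Ln (1 - u i * t)))"
    by (intro ext, rename_tac F, case_tac "finite F") (simp_all add: powr_def exp_sum)
  have "((\<lambda>F. exp (\<Sum>i\<in>F. - c i * Ln (1 - u i * t))) \<longlongrightarrow>
            exp (\<Sum>\<^sub>\<infinity>i. - c i * Ln (1 - u i * t))) (finite_subsets_at_top UNIV)"
    using log_product_has_sum(1)[OF t] unfolding has_sum_def by (rule tendsto_exp)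
  then show ?thesis by (simp add: has_infprod_def *)
qed

lemma infprod_product:
  assumes t: "cmod t < 1"
  shows "infprod (\<lambda>i. (1 - u i * t) powr (- c i)) UNIV = exp (\<Sum>\<^sub>\<infinity>i. - c i * Ln (1 - u i * t))"
  using product_has_infprod[OF t] unfolding has_infprod_def infprod_def
  by (auto intro!: tendsto_Lim)

lemma infprod_product_holomorphic:
  "(\<lambda>t. infprod (\<lambda>i. (1 - u i * t) powr (- c i)) UNIV) holomorphic_on ball 0 1"
proof -
  define a where "a j = (if j = 0 then 0 else (\<Sum>\<^sub>\<infinity>i. c i * u i ^ j) / of_nat j)" for j
  have "(\<lambda>j. a j * (t - 0) ^ j) sums (\<Sum>\<^sub>\<infinity>i. - c i * Ln (1 - u i * t))" if "t \<in> ball 0 1" for t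
    using log_product_has_sum(2)[of t] that sums_Suc_iff[of "\<lambda>j. a j * t ^ j"] by (simp add: a_def)
  then have "(\<lambda>t. \<Sum>\<^sub>\<infinity>i. - c i * Ln (1 - u i * t)) holomorphic_on ball 0 1"
    by (rule power_series_holomorphic)
  then have "(\<lambda>t. exp (\<Sum>\<^sub>\<infinity>i. - c i * Ln (1 - u i * t))) holomorphic_on ball 0 1"
    by (intro holomorphic_intros)
  then show ?thesis
    by (rule holomorphic_transform) (simp add: infprod_product)
qed

text \<open>The recursion compares coefficients in \<open>P' = S' * P\<close>, where \<open>P = exp S\<close> is the product and \<open>S\<close> its logarithm.\<close>
lemma infprod_product_coeff:
  defines "e \<equiv> fps_nth (fps_expansion (\<lambda>t. infprod (\<lambda>i. (1 - u i * t) powr (- c i)) UNIV) 0)"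
  shows "e 0 = 1"
    and "of_nat (Suc n) * e (Suc n) = (\<Sum>k\<le>n. (\<Sum>\<^sub>\<infinity>i. c i * u i ^ Suc k) * e (n - k))"
proof -
  define A where "A = Abs_fps (\<lambda>j. if j = 0 then 0 else (\<Sum>\<^sub>\<infinity>i. c i * u i ^ j) / of_nat j)"
  have ser: "(\<lambda>j. fps_nth A j * t ^ j) sums (\<Sum>\<^sub>\<infinity>i. - c i * Ln (1 - u i * t))" if "t \<in> ball 0 1" for t
    using log_product_has_sum(2)[of t] that sums_Suc_iff[of "\<lambda>j. fps_nth A j * t ^ j"] by (simp add: A_def)
  have near: "eventually (\<lambda>t::complex. t \<in> ball 0 1) (nhds 0)"
    by (intro eventually_nhds_in_open) auto
  have "(\<lambda>t. \<Sum>\<^sub>\<infinity>i. - c i * Ln (1 - u i * t)) has_fps_expansion A"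
    by (rule has_fps_expansionI) (use near in \<open>rule eventually_mono\<close>, use ser in auto)
  then have "(exp \<circ> (\<lambda>t. \<Sum>\<^sub>\<infinity>i. - c i * Ln (1 - u i * t))) has_fps_expansion (fps_exp 1 oo A)"
    by (intro has_fps_expansion_compose fps_expansion_intros) (auto simp: A_def)
  moreover have "eventually (\<lambda>t. (exp \<circ> (\<lambda>t. \<Sum>\<^sub>\<infinity>i. - c i * Ln (1 - u i * t))) t =
                    infprod (\<lambda>i. (1 - u i * t) powr (- c i)) UNIV) (nhds 0)"
    by (use near in \<open>rule eventually_mono\<close>) (simp add: infprod_product)
  ultimately have "(\<lambda>t. infprod (\<lambda>i. (1 - u i * t) powr (- c i)) UNIV) has_fps_expansion (fps_exp 1 oo A)"
    by (simp only: has_fps_expansion_cong[OF _ refl])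
  then have e: "e = fps_nth (fps_exp 1 oo A)"
    unfolding e_def by (simp add: fps_expansion_eqI)
  show "e 0 = 1" by (simp add: e)
  have "fps_deriv (fps_exp 1 oo A) = fps_deriv A * (fps_exp 1 oo A)"
    by (subst fps_compose_deriv) (auto simp: A_def mult.commute)
  then have "fps_nth (fps_deriv (fps_exp 1 oo A)) n = (\<Sum>k=0..n. fps_nth (fps_deriv A) k * e (n - k))"
    by (simp add: fps_mult_nth e)
  then show "of_nat (Suc n) * e (Suc n) = (\<Sum>k\<le>n. (\<Sum>\<^sub>\<infinity>i. c i * u i ^ Suc k) * e (n - k))"
    by (simp add: e A_def atLeast0AtMost del: of_nat_Suc)
qed

end

section \<open>Holomorphic functions of several variables\<close>

text \<open>Termwise differentiation, with a Weierstrass majorant for the derivatives; complex linearity of the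
  derivative passes to the limit.\<close>
lemma holomorphic_several_sums:
  fixes F :: "nat \<Rightarrow> complex ^ 'n \<Rightarrow> complex"
  assumes S: "convex S" "open S"
    and F: "\<And>n z. z \<in> S \<Longrightarrow> (F n has_derivative D n z) (at z)"
    and lin: "\<And>n z c v. z \<in> S \<Longrightarrow> D n z (c *s v) = c * D n z v"
    and bound: "\<And>n z v. z \<in> S \<Longrightarrow> cmod (D n z v) \<le> B n * norm v"
    and B: "summable B"
    and sums: "\<And>z. z \<in> S \<Longrightarrow> (\<lambda>n. F n z) sums G z"
  shows "holomorphic_several G S"
  unfolding holomorphic_several_def
proof
  fix z assume z: "z \<in> S"
  define D' where "D' = (\<lambda>z v. \<Sum>n. D n z v)"
  have Bv: "summable (\<lambda>n. B n * norm v)" for v :: "complex ^ 'n"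
    using B by (rule summable_mult2)
  have nsm: "summable (\<lambda>n. cmod (D n z v))" if "z \<in> S" for z v
    using bound[OF that] by (intro summable_comparison_test'[OF Bv[of v], where N = 0]) auto
  have sm: "summable (\<lambda>n. D n z v)" if "z \<in> S" for z v
    using nsm[OF that] by (rule summable_norm_cancel)
  have unif: "\<forall>\<^sub>F n in sequentially. \<forall>z\<in>S. \<forall>v. cmod ((\<Sum>i<n. D i z v) - D' z v) \<le> e * norm v"
    if "e > 0" for e :: real
  proof -
    have "(\<lambda>n. \<Sum>i. B (i + n)) \<longlonglongrightarrow> 0"
      using B by (rule suminf_exist_split2)
    then have "\<forall>\<^sub>F n in sequentially. (\<Sum>i. B (i + n)) < e"
      using that by (rule order_tendstoD)
    then show ?thesis
    proof (rule eventually_mono, intro ballI allI)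
      fix n z v assume n: "(\<Sum>i. B (i + n)) < e" and z: "z \<in> S"
      have "D' z v - (\<Sum>i<n. D i z v) = (\<Sum>i. D (i + n) z v)"
        using suminf_split_initial_segment[OF sm[OF z, of v], of n] by (simp add: D'_def)
      then have "cmod ((\<Sum>i<n. D i z v) - D' z v) = cmod (\<Sum>i. D (i + n) z v)"
        by (metis norm_minus_commute)
      also have "\<dots> \<le> (\<Sum>i. B (i + n) * norm v)"
        using bound[OF z] summable_ignore_initial_segment[OF Bv[of v], of n]
        by (intro norm_suminf_le) auto
      also have "\<dots> = (\<Sum>i. B (i + n)) * norm v"
        using summable_ignore_initial_segment[OF B, of n] by (simp add: suminf_mult2)
      also have "\<dots> \<le> e * norm v" using n by (intro mult_right_mono) auto
      finally show "cmod ((\<Sum>i<n. D i z v) - D' z v) \<le> e * norm v" .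
    qed
  qed
  have "\<exists>g. \<forall>z\<in>S. (\<lambda>n. F n z) sums g z \<and> (g has_derivative D' z) (at z within S)"
    using S(1) has_derivative_at_withinI[OF F] unif z sums[OF z] by (rule has_derivative_series)
  then obtain g where g: "\<And>z. z \<in> S \<Longrightarrow> (\<lambda>n. F n z) sums g z"
      "\<And>z. z \<in> S \<Longrightarrow> (g has_derivative D' z) (at z within S)" by blast
  have "(G has_derivative D' z) (at z)"
    using g(2)[OF z] z S(2) sums_unique2[OF g(1) sums]
    by (metis at_within_open has_derivative_transform)
  moreover have "D' z (c *s v) = c * D' z v" for c v
    unfolding D'_def using sm[OF z] lin[OF z] by (simp add: suminf_mult)
  ultimately show "\<exists>D. (G has_derivative D) (at z) \<and> (\<forall>c v. D (c *s v) = c * D v)"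
    by blast
qed

lemma holomorphic_several_exp:
  assumes "holomorphic_several G S"
  shows "holomorphic_several (\<lambda>z. exp (G z)) S"
  unfolding holomorphic_several_def
proof
  fix z assume "z \<in> S"
  then obtain D where D: "(G has_derivative D) (at z)" "\<And>c v. D (c *s v) = c * D v"
    using assms by (auto simp: holomorphic_several_def)
  have "(exp has_derivative (*) (exp (G z))) (at (G z))"
    using DERIV_exp[of "G z"] by (simp add: has_field_derivative_def)
  with D(1) have "((\<lambda>z. exp (G z)) has_derivative (\<lambda>v. exp (G z) * D v)) (at z)"
    by (rule has_derivative_compose)
  then show "\<exists>D. ((\<lambda>z. exp (G z)) has_derivative D) (at z) \<and> (\<forall>c v. D (c *s v) = c * D v)"
    using D(2) by (intro exI[of _ "\<lambda>v. exp (G z) * D v"]) auto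
qed

lemma holomorphic_several_transform:
  assumes "holomorphic_several G S" "open S" "\<And>z. z \<in> S \<Longrightarrow> F z = G z"
  shows "holomorphic_several F S"
  unfolding holomorphic_several_def
proof
  fix z assume z: "z \<in> S"
  then obtain D where D: "(G has_derivative D) (at z)" "\<And>c v. D (c *s v) = c * D v"
    using assms by (auto simp: holomorphic_several_def)
  have "(F has_derivative D) (at z)"
    using D(1) assms(2) z by (rule has_derivative_transform_within_open) (simp add: assms(3))
  with D(2) show "\<exists>D. (F has_derivative D) (at z) \<and> (\<forall>c v. D (c *s v) = c * D v)"
    by blast
qed

lemma holomorphic_several_locally:
  assumes "\<And>z. z \<in> S \<Longrightarrow> \<exists>T. z \<in> T \<and> holomorphic_several F T"
  shows "holomorphic_several F S"
  using assms unfolding holomorphic_several_def by blast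

text \<open>A derivative estimate that costs only a slightly larger radius: each term of the geometric
  factorisation of \<open>\<sigma> ^ k - \<rho> ^ k\<close> is at least \<open>\<rho> ^ (k - 1)\<close>.\<close>
lemma power_deriv_le:
  fixes \<rho> \<sigma> :: real
  assumes "0 \<le> \<rho>" "\<rho> < \<sigma>"
  shows "real k * \<rho> ^ (k - 1) \<le> \<sigma> ^ k / (\<sigma> - \<rho>)"
proof -
  have "(\<Sum>i<k. \<rho> ^ (k - 1)) \<le> (\<Sum>i<k. \<sigma> ^ i * \<rho> ^ (k - Suc i))"
  proof (rule sum_mono)
    fix i assume i: "i \<in> {..<k}"
    then have "\<rho> ^ (k - 1) = \<rho> ^ i * \<rho> ^ (k - Suc i)" by (simp flip: power_add)
    also have "\<dots> \<le> \<sigma> ^ i * \<rho> ^ (k - Suc i)"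
      using assms by (intro mult_right_mono power_mono) auto
    finally show "\<rho> ^ (k - 1) \<le> \<sigma> ^ i * \<rho> ^ (k - Suc i)" .
  qed
  then have "(\<sigma> - \<rho>) * (real k * \<rho> ^ (k - 1)) \<le> (\<sigma> - \<rho>) * (\<Sum>i<k. \<sigma> ^ i * \<rho> ^ (k - Suc i))"
    using assms by (intro mult_left_mono) auto
  also have "\<dots> = \<sigma> ^ k - \<rho> ^ k"
    by (simp add: power_diff_sumr2 mult_ac)
  also have "\<dots> \<le> \<sigma> ^ k" using assms by simp
  finally show ?thesis using assms by (simp add: field_simps)
qed

text \<open>On the set \<open>S\<close> the logarithms stay away from the singularity because their arguments have distance
  at most \<open>\<rho>3 < 1\<close> from \<open>1\<close>. The partial derivatives of the monomials on the polydisc of radii \<open>\<rho>1\<close>, \<open>\<rho>2\<close> are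
  controlled by the monomials at the larger radii \<open>\<sigma>1\<close>, \<open>\<sigma>2\<close>, where the coefficients are summable.\<close>
lemma log_series_holomorphic_several:
  fixes c \<beta> :: "nat \<times> nat \<Rightarrow> complex" and \<rho>1 \<rho>2 \<rho>3 \<sigma>1 \<sigma>2 :: real
    and S :: "(complex ^ 3) set"
  assumes S: "convex S" "open S"
    and \<rho>: "0 \<le> \<rho>1" "\<rho>1 < \<sigma>1" "0 \<le> \<rho>2" "\<rho>2 < \<sigma>2" "\<rho>3 < 1"
    and \<beta>: "\<And>k. cmod (\<beta> k) \<le> 1"
    and summ: "(\<lambda>(k1, k2). cmod (c (k1, k2)) * \<sigma>1 ^ k1 * \<sigma>2 ^ k2) summable_on UNIV"
    and z: "\<And>z. z \<in> S \<Longrightarrow> cmod (z $ 1) \<le> \<rho>1" "\<And>z. z \<in> S \<Longrightarrow> cmod (z $ 2) \<le> \<rho>2"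
       "\<And>z. z \<in> S \<Longrightarrow> cmod (z $ 1) \<le> 1" "\<And>z. z \<in> S \<Longrightarrow> cmod (z $ 2) \<le> 1" "\<And>z. z \<in> S \<Longrightarrow> cmod (z $ 3) \<le> \<rho>3"
    and sums: "\<And>z. z \<in> S \<Longrightarrow>
       ((\<lambda>(k1, k2). - c (k1, k2) * Ln (1 - \<beta> (k1, k2) * (z $ 1) ^ k1 * (z $ 2) ^ k2 * (z $ 3))) has_sum G z) UNIV"
  shows "holomorphic_several G S"
proof -
  define mon where "mon k z = (case k of (k1, k2) \<Rightarrow> \<beta> k * (z $ 1) ^ k1 * (z $ 2) ^ k2 * (z $ 3))"
    for k and z :: "complex ^ 3"
  define dmon where "dmon k z v = (case k of (k1, k2) \<Rightarrow>
      \<beta> k * ((of_nat k1 * (z $ 1) ^ (k1 - 1) * (v $ 1)) * (z $ 2) ^ k2 * (z $ 3) +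
             (z $ 1) ^ k1 * (of_nat k2 * (z $ 2) ^ (k2 - 1) * (v $ 2)) * (z $ 3) +
             (z $ 1) ^ k1 * (z $ 2) ^ k2 * (v $ 3)))"
    for k and z v :: "complex ^ 3"
  define C where "C = (1 / (\<sigma>1 - \<rho>1) + 1 / (\<sigma>2 - \<rho>2) + 1) / (1 - \<rho>3)"
  define B where "B k = (case k of (k1, k2) \<Rightarrow> cmod (c (k1, k2)) * \<sigma>1 ^ k1 * \<sigma>2 ^ k2) * C" for k
  have mon_le: "cmod (mon k z) \<le> \<rho>3" if "z \<in> S" for k z
  proof -
    obtain k1 k2 where k: "k = (k1, k2)" by fastforce
    have "cmod (\<beta> k) * cmod (z $ 1) ^ k1 * cmod (z $ 2) ^ k2 * cmod (z $ 3) \<le> 1 * 1 * 1 * \<rho>3"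
      using \<beta> z[OF that] by (intro mult_mono power_le_one) auto
    then show ?thesis by (simp add: mon_def k norm_mult norm_power)
  qed
  have mon_nz: "1 - mon k z \<notin> \<real>\<^sub>\<le>\<^sub>0" if "z \<in> S" for k z
  proof -
    have "Re (mon k z) < 1" using mon_le[OF that, of k] \<rho>(5) complex_Re_le_cmod[of "mon k z"] by linarith
    then show ?thesis by (auto simp: complex_nonpos_Reals_iff)
  qed
  have dmon_le: "cmod (dmon k z v) \<le> (\<sigma>1 ^ fst k * \<sigma>2 ^ snd k) * (1 / (\<sigma>1 - \<rho>1) + 1 / (\<sigma>2 - \<rho>2) + 1) * norm v"
    if "z \<in> S" for k z v
  proof -
    obtain k1 k2 where k: "k = (k1, k2)" by fastforce
    let ?a = "cmod (z $ 1)" and ?b = "cmod (z $ 2)" and ?d = "cmod (z $ 3)"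
    note zz = z[OF that]
    have d1: "?d \<le> 1" using zz(5) \<rho> by simp
    have pa: "?a ^ k1 \<le> \<sigma>1 ^ k1" and pb: "?b ^ k2 \<le> \<sigma>2 ^ k2"
      using zz \<rho> by (auto intro!: power_mono)
    have da: "real k1 * ?a ^ (k1 - 1) \<le> \<sigma>1 ^ k1 / (\<sigma>1 - \<rho>1)"
      using power_deriv_le[OF \<rho>(1,2), of k1] zz(1) power_mono[of ?a \<rho>1 "k1 - 1"]
        mult_left_mono[of "?a ^ (k1 - 1)" "\<rho>1 ^ (k1 - 1)" "real k1"] by simp
    have db: "real k2 * ?b ^ (k2 - 1) \<le> \<sigma>2 ^ k2 / (\<sigma>2 - \<rho>2)"
      using power_deriv_le[OF \<rho>(3,4), of k2] zz(2) power_mono[of ?b \<rho>2 "k2 - 1"]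
        mult_left_mono[of "?b ^ (k2 - 1)" "\<rho>2 ^ (k2 - 1)" "real k2"] by simp
    have v: "cmod (v $ i) \<le> norm v" for i by (rule Finite_Cartesian_Product.norm_nth_le)
    have "cmod (dmon k z v) \<le> 1 * ((real k1 * ?a ^ (k1 - 1) * cmod (v $ 1)) * ?b ^ k2 * ?d +
        ?a ^ k1 * (real k2 * ?b ^ (k2 - 1) * cmod (v $ 2)) * ?d + ?a ^ k1 * ?b ^ k2 * cmod (v $ 3))"
      unfolding dmon_def k prod.case norm_mult
      by (intro mult_mono \<beta> order.trans[OF norm_triangle_ineq] add_mono)
         (auto simp: norm_mult norm_power)
    also have "\<dots> \<le> 1 * ((\<sigma>1 ^ k1 / (\<sigma>1 - \<rho>1) * norm v) * \<sigma>2 ^ k2 * 1 +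
        \<sigma>1 ^ k1 * (\<sigma>2 ^ k2 / (\<sigma>2 - \<rho>2) * norm v) * 1 + \<sigma>1 ^ k1 * \<sigma>2 ^ k2 * norm v)"
      using \<rho> by (intro mult_mono add_mono pa pb da db v d1 order.refl) auto
    also have "\<dots> = (\<sigma>1 ^ fst k * \<sigma>2 ^ snd k) * (1 / (\<sigma>1 - \<rho>1) + 1 / (\<sigma>2 - \<rho>2) + 1) * norm v"
      by (simp add: k algebra_simps)
    finally show ?thesis .
  qed
  have dlin: "dmon k z (a *s v) = a * dmon k z v" for k z a v
    by (cases k) (simp add: dmon_def algebra_simps)
  have dm: "(mon k has_derivative dmon k z) (at z)" for k z
  proof (cases k)
    case (Pair k1 k2)
    show ?thesis unfolding mon_def[abs_def] dmon_def[abs_def] Pair prod.case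
      by (auto intro!: derivative_eq_intros bounded_linear.has_derivative[OF bounded_linear_vec_nth]
          simp: fun_eq_iff algebra_simps)
  qed
  define F where "F n z = - c (prod_decode n) * Ln (1 - mon (prod_decode n) z)" for n z
  define D where "D n z v = c (prod_decode n) * dmon (prod_decode n) z v / (1 - mon (prod_decode n) z)" for n z v
  show ?thesis
  proof (rule holomorphic_several_sums[OF S, where F = F and D = D and B = "\<lambda>n. B (prod_decode n)"])
    fix n z assume z: "z \<in> S"
    define k where "k = prod_decode n"
    have "((\<lambda>w. 1 - mon k w) has_derivative (\<lambda>v. 0 - dmon k z v)) (at z)"
      by (intro has_derivative_diff has_derivative_const dm)
    moreover have "(Ln has_derivative (*) (inverse (1 - mon k z))) (at (1 - mon k z))"
      using has_field_derivative_Ln[OF mon_nz[OF z, of k]] by (simp add: has_field_derivative_def)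
    ultimately have "((\<lambda>w. Ln (1 - mon k w)) has_derivative
        (\<lambda>v. inverse (1 - mon k z) * (0 - dmon k z v))) (at z)"
      by (rule has_derivative_compose)
    then have "((\<lambda>w. - c k * Ln (1 - mon k w)) has_derivative
        (\<lambda>v. - c k * (inverse (1 - mon k z) * (0 - dmon k z v)))) (at z)"
      by (rule has_derivative_mult_right)
    then show "(F n has_derivative D n z) (at z)"
      by (simp add: F_def[abs_def] D_def[abs_def] k_def field_simps)
  next
    fix n z a v
    show "D n z (a *s v) = a * D n z v" by (simp add: D_def dlin)
  next
    fix n z v assume z: "z \<in> S"
    define k where "k = prod_decode n"
    have "1 - \<rho>3 \<le> cmod (1 - mon k z)"
      using norm_triangle_ineq2[of 1 "mon k z"] mon_le[OF z, of k] by simp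
    then have "cmod (D n z v) \<le> cmod (c k) * ((\<sigma>1 ^ fst k * \<sigma>2 ^ snd k) * (1 / (\<sigma>1 - \<rho>1) + 1 / (\<sigma>2 - \<rho>2) + 1) * norm v) / (1 - \<rho>3)"
      unfolding D_def k_def[symmetric] norm_divide norm_mult using \<rho> dmon_le[OF z, of k v]
      by (intro frac_le mult_left_mono) auto
    also have "\<dots> = B k * norm v" by (simp add: B_def C_def case_prod_unfold mult_ac)
    finally show "cmod (D n z v) \<le> B (prod_decode n) * norm v" by (simp add: k_def)
  next
    have "B summable_on UNIV" unfolding B_def using summ by (rule summable_on_cmult_left)
    then have "(\<lambda>n. B (prod_decode n)) summable_on UNIV"
      using summable_on_reindex_bij_betw[OF bij_prod_decode, of B] by simp
    then show "summable (\<lambda>n. B (prod_decode n))" by (rule summable_on_imp_summable)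
  next
    fix z assume "z \<in> S"
    from sums[OF this] have "((\<lambda>k. - c k * Ln (1 - mon k z)) has_sum G z) UNIV"
      by (simp add: mon_def case_prod_unfold)
    then have "((\<lambda>n. F n z) has_sum G z) UNIV"
      unfolding F_def by (subst has_sum_reindex_bij_betw[OF bij_prod_decode])
    then show "(\<lambda>n. F n z) sums G z" by (rule has_sum_imp_sums)
  qed
qed

section \<open>Expectations of products over independent blocks\<close>

lemma space_circle_pairs: "space circle_pairs = sphere 0 1 \<times> sphere 0 1"
  by (simp add: circle_pairs_def space_restrict_space)

lemma fst_circle_pairs_measurable: "fst \<in> borel_measurable circle_pairs"
  and snd_circle_pairs_measurable: "snd \<in> borel_measurable circle_pairs"
  unfolding circle_pairs_def
  by (intro measurable_restrict_space1 borel_measurable_continuous_onI continuous_intros)+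

lemma measurable_into_circle_pairs:
  assumes "f \<in> borel_measurable M" "g \<in> borel_measurable M"
    and "\<And>\<omega>. \<omega> \<in> space M \<Longrightarrow> f \<omega> \<in> sphere 0 1" "\<And>\<omega>. \<omega> \<in> space M \<Longrightarrow> g \<omega> \<in> sphere 0 1"
  shows "(\<lambda>\<omega>. (f \<omega>, g \<omega>)) \<in> measurable M circle_pairs"
  unfolding circle_pairs_def using assms
  by (intro measurable_restrict_space2 borel_measurable_Pair) auto

text \<open>The mixed moments of the law \<open>L\<close> of a pair of points on the unit circle.\<close>
definition circle_moment :: "(complex \<times> complex) measure \<Rightarrow> nat \<Rightarrow> nat \<Rightarrow> complex" where
  "circle_moment L k1 k2 = (\<integral>z. fst z ^ k1 * snd z ^ k2 \<partial>L)"

lemma prod_in_circle: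
  assumes "z \<in> space (PiM J (\<lambda>_. circle_pairs))"
  shows "(\<Prod>i\<in>J. fst (z i)) \<in> sphere 0 1" "(\<Prod>i\<in>J. snd (z i)) \<in> sphere 0 1"
proof -
  have "cmod (fst (z i)) = 1 \<and> cmod (snd (z i)) = 1" if "i \<in> J" for i
    using assms that by (auto simp: space_PiM PiE_iff space_circle_pairs mem_Times_iff)
  then show "(\<Prod>i\<in>J. fst (z i)) \<in> sphere 0 1" "(\<Prod>i\<in>J. snd (z i)) \<in> sphere 0 1"
    by (auto simp: prod_norm[symmetric])
qed

lemma prod_circle_measurable:
  shows "(\<lambda>z. \<Prod>i\<in>J. fst (z i)) \<in> borel_measurable (PiM J (\<lambda>_. circle_pairs))"
    and "(\<lambda>z. \<Prod>i\<in>J. snd (z i)) \<in> borel_measurable (PiM J (\<lambda>_. circle_pairs))"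
proof -
  have proj: "(\<lambda>z. z i) \<in> measurable (PiM J (\<lambda>_. circle_pairs)) circle_pairs" if "i \<in> J" for i
    using measurable_component_singleton[OF that, of "\<lambda>_. circle_pairs"] .
  show "(\<lambda>z. \<Prod>i\<in>J. fst (z i)) \<in> borel_measurable (PiM J (\<lambda>_. circle_pairs))"
    by (intro borel_measurable_prod measurable_compose[OF proj fst_circle_pairs_measurable])
  show "(\<lambda>z. \<Prod>i\<in>J. snd (z i)) \<in> borel_measurable (PiM J (\<lambda>_. circle_pairs))"
    by (intro borel_measurable_prod measurable_compose[OF proj snd_circle_pairs_measurable])
qed

text \<open>The value types of the two random variables in \<^const>\<open>prob_space.indep_var\<close> must agree, whereas a random
  permutation and a family of random pairs have different ones. Independence is therefore kept at
  the level of the generated sigma-algebras and passed to complex functions measurable with respect to them.\<close>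
lemma (in prob_space) indep_var_if_measurable_indep:
  assumes indep: "indep_set (sets A) (sets B)" and sp: "space A = space M" "space B = space M"
    and X: "X \<in> measurable A S" and Y: "Y \<in> measurable B T"
  shows "indep_var S X T Y"
proof -
  have ev: "sets A \<subseteq> events" "sets B \<subseteq> events"
    using indep by (auto simp: indep_set_def UNIV_bool indep_sets_def)
  have rv: "random_variable S X" "random_variable T Y"
    using X Y ev sp by (auto simp: measurable_def)
  have gen: "sigma_sets (space M) {X -` C \<inter> space M | C. C \<in> sets S} \<subseteq> sets A"
      "sigma_sets (space M) {Y -` C \<inter> space M | C. C \<in> sets T} \<subseteq> sets B"
    using measurable_sets[OF X] measurable_sets[OF Y]
      sets.sigma_sets_subset[of "{X -` C \<inter> space M | C. C \<in> sets S}" A]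
      sets.sigma_sets_subset[of "{Y -` C \<inter> space M | C. C \<in> sets T}" B]
    unfolding sp by auto
  have "indep_set (sigma_sets (space M) {X -` C \<inter> space M | C. C \<in> sets S})
                  (sigma_sets (space M) {Y -` C \<inter> space M | C. C \<in> sets T})"
    using indep unfolding indep_set_def
    by (rule indep_sets_mono_sets) (use gen in \<open>auto split: bool.split\<close>)
  with rv show ?thesis by (simp add: indep_var_eq)
qed

text \<open>Let \<open>F\<close> be given on the torus by an absolutely convergent double power series. The factor belonging to
  one cycle has the form \<open>F u v\<close> with \<open>u\<close> and \<open>v\<close> products of independent points of the circle.\<close>
context
  fixes F :: "complex \<Rightarrow> complex \<Rightarrow> complex" and d :: "nat \<Rightarrow> nat \<Rightarrow> complex"
  assumes F: "\<And>u v. u \<in> sphere 0 1 \<Longrightarrow> v \<in> sphere 0 1 \<Longrightarrow>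
      ((\<lambda>(k1, k2). d k1 k2 * u ^ k1 * v ^ k2) has_sum F u v) UNIV"
begin

lemma circle_series_abs_summable: "(\<lambda>(k1, k2). cmod (d k1 k2)) summable_on UNIV"
proof -
  have "(\<lambda>(k1, k2). d k1 k2 * 1 ^ k1 * 1 ^ k2) summable_on UNIV"
    using F[of 1 1] by (auto simp: summable_on_def)
  then show ?thesis
    by (subst (asm) summable_on_iff_abs_summable_on_complex) (simp add: case_prod_unfold)
qed

lemma circle_series_sums:
  assumes "u \<in> sphere 0 1" "v \<in> sphere 0 1"
  shows "(\<lambda>n. case prod_decode n of (k1, k2) \<Rightarrow> d k1 k2 * u ^ k1 * v ^ k2) sums F u v"
proof -
  have "((\<lambda>n. (\<lambda>(k1, k2). d k1 k2 * u ^ k1 * v ^ k2) (prod_decode n)) has_sum F u v) UNIV"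
    using F[OF assms] by (subst has_sum_reindex_bij_betw[OF bij_prod_decode])
  then show ?thesis by (rule has_sum_imp_sums)
qed

lemma circle_series_prod_measurable:
  "(\<lambda>z. F (\<Prod>i\<in>J. fst (z i)) (\<Prod>i\<in>J. snd (z i))) \<in> borel_measurable (PiM J (\<lambda>_. circle_pairs))"
proof -
  let ?u = "\<lambda>z. \<Prod>i\<in>J. fst (z i :: complex \<times> complex)" and ?v = "\<lambda>z. \<Prod>i\<in>J. snd (z i :: complex \<times> complex)"
  have meas: "(\<lambda>z. \<Sum>n. case prod_decode n of (k1, k2) \<Rightarrow> d k1 k2 * ?u z ^ k1 * ?v z ^ k2)
      \<in> borel_measurable (PiM J (\<lambda>_. circle_pairs))"
    unfolding case_prod_unfold
    by (intro borel_measurable_suminf borel_measurable_times borel_measurable_const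
        borel_measurable_power prod_circle_measurable)
  have eq: "(\<Sum>n. case prod_decode n of (k1, k2) \<Rightarrow> d k1 k2 * ?u z ^ k1 * ?v z ^ k2) = F (?u z) (?v z)"
    if "z \<in> space (PiM J (\<lambda>_. circle_pairs))" for z
    using prod_in_circle[OF that] by (intro sums_unique[symmetric] circle_series_sums)
  from measurable_cong[OF eq] meas show ?thesis by (rule iffD1)
qed

text \<open>The series is integrated term by term. By independence the moment of a product over \<open>J\<close>
  is the \<open>card J\<close>-th power of the moment of a single pair.\<close>
lemma has_bochner_integral_circle_series:
  assumes N: "prob_space N" and J: "finite J"
    and indep: "prob_space.indep_vars N (\<lambda>_. circle_pairs) \<Theta> J"
    and law: "\<And>i. i \<in> J \<Longrightarrow> distr N circle_pairs (\<Theta> i) = L"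
  shows "has_bochner_integral N (\<lambda>\<omega>. F (\<Prod>i\<in>J. fst (\<Theta> i \<omega>)) (\<Prod>i\<in>J. snd (\<Theta> i \<omega>)))
           (\<Sum>\<^sub>\<infinity>(k1, k2). d k1 k2 * circle_moment L k1 k2 ^ card J)"
proof -
  interpret prob_space N by fact
  let ?u = "\<lambda>\<omega>. \<Prod>i\<in>J. fst (\<Theta> i \<omega>)" and ?v = "\<lambda>\<omega>. \<Prod>i\<in>J. snd (\<Theta> i \<omega>)"
  have rv: "\<Theta> i \<in> measurable N circle_pairs" if "i \<in> J" for i
    using indep that by (auto simp: indep_vars_def)
  have in_circle: "fst (\<Theta> i \<omega>) \<in> sphere 0 1" "snd (\<Theta> i \<omega>) \<in> sphere 0 1" if "i \<in> J" "\<omega> \<in> space N" for i \<omega>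
    using measurable_space[OF rv[OF that(1)] that(2)] by (auto simp: space_circle_pairs mem_Times_iff)
  have uv: "?u \<omega> \<in> sphere 0 1" "?v \<omega> \<in> sphere 0 1" if "\<omega> \<in> space N" for \<omega>
    using in_circle[OF _ that] by (auto simp: prod_norm[symmetric])
  have mom_meas: "(\<lambda>z. fst z ^ k1 * snd z ^ k2) \<in> borel_measurable circle_pairs" for k1 k2
    by (intro borel_measurable_times borel_measurable_power fst_circle_pairs_measurable snd_circle_pairs_measurable)
  have mom: "integrable N (\<lambda>\<omega>. ?u \<omega> ^ k1 * ?v \<omega> ^ k2)"
    "(\<integral>\<omega>. ?u \<omega> ^ k1 * ?v \<omega> ^ k2 \<partial>N) = circle_moment L k1 k2 ^ card J" for k1 k2
  proof -
    have ind: "indep_vars (\<lambda>_. borel) (\<lambda>i \<omega>. fst (\<Theta> i \<omega>) ^ k1 * snd (\<Theta> i \<omega>) ^ k2) J"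
      using indep_vars_compose2[OF indep, of "\<lambda>_ z. fst z ^ k1 * snd z ^ k2" "\<lambda>_. borel"] mom_meas by simp
    have int: "integrable N (\<lambda>\<omega>. fst (\<Theta> i \<omega>) ^ k1 * snd (\<Theta> i \<omega>) ^ k2)" if "i \<in> J" for i
    proof (rule integrable_const_bound[of _ 1])
      show "(\<lambda>\<omega>. fst (\<Theta> i \<omega>) ^ k1 * snd (\<Theta> i \<omega>) ^ k2) \<in> borel_measurable N"
        using measurable_compose[OF rv[OF that] mom_meas] .
      show "AE \<omega> in N. cmod (fst (\<Theta> i \<omega>) ^ k1 * snd (\<Theta> i \<omega>) ^ k2) \<le> 1"
        using in_circle[OF that] by (intro AE_I2) (simp add: norm_mult norm_power)
    qed
    have eq: "?u \<omega> ^ k1 * ?v \<omega> ^ k2 = (\<Prod>i\<in>J. fst (\<Theta> i \<omega>) ^ k1 * snd (\<Theta> i \<omega>) ^ k2)" for \<omega>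
      by (simp add: prod_power_distrib prod.distrib)
    have "(\<integral>\<omega>. fst (\<Theta> i \<omega>) ^ k1 * snd (\<Theta> i \<omega>) ^ k2 \<partial>N) = circle_moment L k1 k2" if "i \<in> J" for i
      unfolding circle_moment_def law[OF that, symmetric]
      by (subst integral_distr[OF rv[OF that] mom_meas]) simp
    then show "integrable N (\<lambda>\<omega>. ?u \<omega> ^ k1 * ?v \<omega> ^ k2)"
      "(\<integral>\<omega>. ?u \<omega> ^ k1 * ?v \<omega> ^ k2 \<partial>N) = circle_moment L k1 k2 ^ card J"
      unfolding eq using indep_vars_integrable[OF J ind int] indep_vars_lebesgue_integral[OF J ind int]
      by simp_all
  qed
  define T where "T n \<omega> = (case prod_decode n of (k1, k2) \<Rightarrow> d k1 k2 * ?u \<omega> ^ k1 * ?v \<omega> ^ k2)" for n \<omega>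
  have T: "(\<lambda>n. T n \<omega>) sums F (?u \<omega>) (?v \<omega>)" if "\<omega> \<in> space N" for \<omega>
    unfolding T_def using uv[OF that] by (rule circle_series_sums)
  have T_int: "integrable N (T n)"
    "(\<integral>\<omega>. T n \<omega> \<partial>N) = (case prod_decode n of (k1, k2) \<Rightarrow> d k1 k2 * circle_moment L k1 k2 ^ card J)" for n
    unfolding T_def[abs_def] case_prod_unfold mult.assoc using mom by simp_all
  have T_norm: "cmod (T n \<omega>) = (case prod_decode n of (k1, k2) \<Rightarrow> cmod (d k1 k2))" if "\<omega> \<in> space N" for n \<omega>
    using uv[OF that] by (simp add: T_def case_prod_unfold norm_mult norm_power)
  have "(\<lambda>n. (\<lambda>(k1, k2). cmod (d k1 k2)) (prod_decode n)) summable_on UNIV"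
    using circle_series_abs_summable by (subst summable_on_reindex_bij_betw[OF bij_prod_decode])
  then have sm: "summable (\<lambda>n. case prod_decode n of (k1, k2) \<Rightarrow> cmod (d k1 k2))"
    by (rule summable_on_imp_summable)
  have AE_sm: "AE \<omega> in N. summable (\<lambda>n. norm (T n \<omega>))"
    by (intro AE_I2) (simp add: T_norm sm)
  have "(\<integral>\<omega>. norm (T n \<omega>) \<partial>N) = (case prod_decode n of (k1, k2) \<Rightarrow> cmod (d k1 k2))" for n
    by (subst Bochner_Integration.integral_cong[OF refl T_norm]) (auto simp: prob_space)
  then have int_sm: "summable (\<lambda>n. \<integral>\<omega>. norm (T n \<omega>) \<partial>N)" using sm by simp
  note * = integrable_suminf[OF T_int(1) AE_sm int_sm] sums_integral[OF T_int(1) AE_sm int_sm]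
  have mom_le: "cmod (circle_moment L k1 k2 ^ card J) \<le> 1" for k1 k2
  proof -
    have "cmod (\<integral>\<omega>. ?u \<omega> ^ k1 * ?v \<omega> ^ k2 \<partial>N) \<le> (\<integral>\<omega>. cmod (?u \<omega> ^ k1 * ?v \<omega> ^ k2) \<partial>N)"
      by (rule integral_norm_bound)
    also have "\<dots> = (\<integral>\<omega>. 1 \<partial>N)"
      using uv by (intro Bochner_Integration.integral_cong) (auto simp: norm_mult norm_power)
    finally have "cmod (\<integral>\<omega>. ?u \<omega> ^ k1 * ?v \<omega> ^ k2 \<partial>N) \<le> (\<integral>\<omega>. 1 \<partial>N)" .
    then show ?thesis by (simp add: mom prob_space)
  qed
  have "(\<lambda>(k1, k2). d k1 k2 * circle_moment L k1 k2 ^ card J) summable_on UNIV"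
  proof (rule abs_summable_summable, rule Infinite_Sum.abs_summable_on_comparison_test')
    show "(\<lambda>(k1, k2). cmod (d k1 k2)) summable_on UNIV" by (rule circle_series_abs_summable)
    show "cmod (case k of (k1, k2) \<Rightarrow> d k1 k2 * circle_moment L k1 k2 ^ card J) \<le> (case k of (k1, k2) \<Rightarrow> cmod (d k1 k2))" for k
      using mom_le by (cases k) (simp only: prod.case norm_mult, intro mult_left_le, auto)
  qed
  then have "((\<lambda>n. (\<lambda>(k1, k2). d k1 k2 * circle_moment L k1 k2 ^ card J) (prod_decode n)) has_sum
     (\<Sum>\<^sub>\<infinity>(k1, k2). d k1 k2 * circle_moment L k1 k2 ^ card J)) UNIV"
    by (subst has_sum_reindex_bij_betw[OF bij_prod_decode]) (rule has_sum_infsum)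
  then have "(\<lambda>n. \<integral>\<omega>. T n \<omega> \<partial>N) sums (\<Sum>\<^sub>\<infinity>(k1, k2). d k1 k2 * circle_moment L k1 k2 ^ card J)"
    unfolding T_int by (rule has_sum_imp_sums)
  with *(2) have "(\<integral>\<omega>. (\<Sum>n. T n \<omega>) \<partial>N) = (\<Sum>\<^sub>\<infinity>(k1, k2). d k1 k2 * circle_moment L k1 k2 ^ card J)"
    by (rule sums_unique2)
  with *(1) have "has_bochner_integral N (\<lambda>\<omega>. \<Sum>n. T n \<omega>) (\<Sum>\<^sub>\<infinity>(k1, k2). d k1 k2 * circle_moment L k1 k2 ^ card J)"
    by (simp add: has_bochner_integral_iff)
  then show ?thesis
    by (rule has_bochner_integral_cong[OF refl _ refl, THEN iffD1, rotated])
       (simp add: sums_unique[OF T, symmetric])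
qed

end

text \<open>The factor with number \<open>m\<close> of the permutation \<open>g\<close> uses the pairs with index in \<open>J g m\<close>, and these blocks are
  disjoint. Conditioning on the permutation is done by hand: the integrand is split over the finitely many events
  \<open>G \<omega> = g\<close>, each of probability \<open>1 / fact n\<close>, and on each of them the factors are independent of each other
  and of the event.\<close>
lemma uniform_perm_with_iid_expectation:
  fixes len :: "(nat \<Rightarrow> nat) \<Rightarrow> nat" and E :: "(nat \<Rightarrow> nat) \<Rightarrow> nat \<Rightarrow> complex"
  assumes U: "uniform_perm_with_iid L n I N G \<Theta>" and I: "finite I"
    and J: "\<And>g m. g permutes {1..n} \<Longrightarrow> m < len g \<Longrightarrow> J g m \<subseteq> I"
    and disj: "\<And>g. g permutes {1..n} \<Longrightarrow> disjoint_family_on (J g) {..<len g}"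
    and H_meas: "\<And>g m. g permutes {1..n} \<Longrightarrow> m < len g \<Longrightarrow>
        (\<lambda>z. H g m (\<Prod>i\<in>J g m. fst (z i)) (\<Prod>i\<in>J g m. snd (z i))) \<in> borel_measurable (PiM (J g m) (\<lambda>_. circle_pairs))"
    and H_int: "\<And>g m. g permutes {1..n} \<Longrightarrow> m < len g \<Longrightarrow>
        has_bochner_integral N (\<lambda>\<omega>. H g m (\<Prod>i\<in>J g m. fst (\<Theta> i \<omega>)) (\<Prod>i\<in>J g m. snd (\<Theta> i \<omega>))) (E g m)"
  shows "has_bochner_integral N
      (\<lambda>\<omega>. \<Prod>m<len (G \<omega>). H (G \<omega>) m (\<Prod>i\<in>J (G \<omega>) m. fst (\<Theta> i \<omega>)) (\<Prod>i\<in>J (G \<omega>) m. snd (\<Theta> i \<omega>)))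
      ((\<Sum>g | g permutes {1..n}. \<Prod>m<len g. E g m) / fact n)"
proof -
  let ?P = "{g. g permutes {1..n}}"
  let ?\<Theta> = "\<lambda>\<omega>. \<lambda>i\<in>I. \<Theta> i \<omega>"
  define h where "h g m z = H g m (\<Prod>i\<in>J g m. fst (z i)) (\<Prod>i\<in>J g m. snd (z i))" for g m z
  interpret prob_space N using U by (simp add: uniform_perm_with_iid_def)
  have G: "G \<in> measurable N (count_space ?P)"
    and distrG: "distr N (count_space ?P) G = uniform_count_measure ?P"
    and ind: "indep_vars (\<lambda>_. circle_pairs) \<Theta> I"
    and indG: "indep_set (sets (vimage_algebra (space N) G (count_space ?P)))
       (sets (vimage_algebra (space N) ?\<Theta> (PiM I (\<lambda>_. circle_pairs))))"
    using U by (simp_all add: uniform_perm_with_iid_def)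
  have rv: "\<Theta> i \<in> measurable N circle_pairs" if "i \<in> I" for i
    using ind that by (auto simp: indep_vars_def)
  have \<Theta>_meas: "?\<Theta> \<in> measurable N (PiM I (\<lambda>_. circle_pairs))"
    by (intro measurable_restrict rv)
  have finP: "finite ?P" by (simp add: finite_permutations)
  have cardP: "card ?P = fact n" by (simp add: card_permutations)
  have each: "has_bochner_integral N (\<lambda>\<omega>. (if G \<omega> = g then 1 else 0) * (\<Prod>m<len g. h g m (\<lambda>i. \<Theta> i \<omega>)))
     (1 / fact n * (\<Prod>m<len g. E g m))" if g: "g permutes {1..n}" for g
  proof -
    have h_meas: "h g m \<in> borel_measurable (PiM (J g m) (\<lambda>_. circle_pairs))" if "m < len g" for m
      unfolding h_def[abs_def] using H_meas[OF g that] .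
    have h_restrict: "h g m (restrict z (J g m)) = h g m z" for m z
      by (simp add: h_def)
    \<comment> \<open>Functions of disjoint blocks of an independent family are independent.\<close>
    have "indep_vars (\<lambda>m. PiM (J g m) (\<lambda>_. circle_pairs)) (\<lambda>m \<omega>. restrict (\<lambda>i. \<Theta> i \<omega>) (J g m)) {..<len g}"
      using J[OF g] by (intro indep_vars_restrict[OF ind _ disj[OF g]]) auto
    then have "indep_vars (\<lambda>_. borel) (\<lambda>m \<omega>. h g m (restrict (\<lambda>i. \<Theta> i \<omega>) (J g m))) {..<len g}"
      by (rule indep_vars_compose2) (auto intro: h_meas)
    then have ind_h: "indep_vars (\<lambda>_. borel) (\<lambda>m \<omega>. h g m (\<lambda>i. \<Theta> i \<omega>)) {..<len g}"
      by (simp add: h_restrict)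
    have int_h: "integrable N (\<lambda>\<omega>. h g m (\<lambda>i. \<Theta> i \<omega>))" "(\<integral>\<omega>. h g m (\<lambda>i. \<Theta> i \<omega>) \<partial>N) = E g m"
      if "m \<in> {..<len g}" for m
      using H_int[OF g, of m] that by (auto simp: has_bochner_integral_iff h_def)
    have V: "integrable N (\<lambda>\<omega>. \<Prod>m<len g. h g m (\<lambda>i. \<Theta> i \<omega>))"
      "(\<integral>\<omega>. (\<Prod>m<len g. h g m (\<lambda>i. \<Theta> i \<omega>)) \<partial>N) = (\<Prod>m<len g. E g m)"
      using indep_vars_integrable[OF finite_lessThan ind_h int_h(1)] indep_vars_lebesgue_integral[OF finite_lessThan ind_h int_h(1)]
      by (simp_all add: int_h)
    have ind_meas: "(\<lambda>p. if p = g then 1 else 0 :: complex) \<in> borel_measurable (count_space ?P)"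
      by simp
    have "(\<lambda>z. h g m z) \<in> borel_measurable (PiM I (\<lambda>_. circle_pairs))" if "m < len g" for m
      using measurable_compose[OF measurable_restrict_subset[OF J[OF g that]] h_meas[OF that]]
      by (simp add: h_restrict)
    then have prod_meas: "(\<lambda>z. \<Prod>m<len g. h g m z) \<in> borel_measurable (PiM I (\<lambda>_. circle_pairs))"
      by (intro borel_measurable_prod) auto
    have "h g m (?\<Theta> \<omega>) = h g m (\<lambda>i. \<Theta> i \<omega>)" if "m < len g" for m \<omega>
      using J[OF g that] unfolding h_def by (intro arg_cong2[where f = "H g m"] prod.cong) auto
    then have "(\<Prod>m<len g. h g m (?\<Theta> \<omega>)) = (\<Prod>m<len g. h g m (\<lambda>i. \<Theta> i \<omega>))" for \<omega>
      by (intro prod.cong) auto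
    moreover have "(\<lambda>\<omega>. if G \<omega> = g then 1 else 0 :: complex)
        \<in> borel_measurable (vimage_algebra (space N) G (count_space ?P))"
      by (rule measurable_compose[OF measurable_vimage_algebra1[of G] ind_meas])
         (intro Pi_I measurable_space[OF G])
    moreover have "(\<lambda>\<omega>. \<Prod>m<len g. h g m (?\<Theta> \<omega>))
        \<in> borel_measurable (vimage_algebra (space N) ?\<Theta> (PiM I (\<lambda>_. circle_pairs)))"
      by (rule measurable_compose[OF measurable_vimage_algebra1[of ?\<Theta>] prod_meas])
         (intro Pi_I measurable_space[OF \<Theta>_meas])
    ultimately have indep: "indep_var borel (\<lambda>\<omega>. if G \<omega> = g then 1 else 0 :: complex)
                 borel (\<lambda>\<omega>. \<Prod>m<len g. h g m (\<lambda>i. \<Theta> i \<omega>))"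
      by (intro indep_var_if_measurable_indep[OF indG]) simp_all
    have int1: "integrable N (\<lambda>\<omega>. if G \<omega> = g then 1 else 0 :: complex)"
      using measurable_compose[OF G ind_meas] by (intro integrable_const_bound[of _ 1]) auto
    have "(\<integral>\<omega>. (if G \<omega> = g then 1 else 0 :: complex) \<partial>N) =
          (\<integral>p. (if p = g then 1 else 0) \<partial>uniform_count_measure ?P)"
      unfolding distrG[symmetric] by (rule integral_distr[OF G ind_meas, symmetric])
    also have "\<dots> = (\<Sum>p\<in>?P. (if p = g then 1 / fact n else 0))"
      unfolding uniform_count_measure_def cardP
      by (subst lebesgue_integral_point_measure_finite[OF finP])
         (auto intro!: sum.cong simp: scaleR_conv_of_real)
    also have "\<dots> = 1 / fact n" using g finP by simp
    finally have I1: "(\<integral>\<omega>. (if G \<omega> = g then 1 else 0 :: complex) \<partial>N) = 1 / fact n" .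
    show ?thesis
      unfolding has_bochner_integral_iff
      using indep_var_integrable[OF indep int1 V(1)] indep_var_lebesgue_integral[OF indep int1 V(1)] I1 V(2)
      by simp
  qed
  have "has_bochner_integral N (\<lambda>\<omega>. \<Sum>g\<in>?P. (if G \<omega> = g then 1 else 0) * (\<Prod>m<len g. h g m (\<lambda>i. \<Theta> i \<omega>)))
     (\<Sum>g\<in>?P. 1 / fact n * (\<Prod>m<len g. E g m))"
    by (intro has_bochner_integral_sum each) simp
  moreover have "(\<Sum>g\<in>?P. (if G \<omega> = g then 1 else 0) * (\<Prod>m<len g. h g m (\<lambda>i. \<Theta> i \<omega>))) =
      (\<Prod>m<len (G \<omega>). h (G \<omega>) m (\<lambda>i. \<Theta> i \<omega>))" if "\<omega> \<in> space N" for \<omega>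
  proof -
    have "G \<omega> \<in> ?P" using measurable_space[OF G that] by simp
    then show ?thesis using finP by (simp add: if_distrib[of "\<lambda>x. x * _"] cong: if_cong)
  qed
  moreover have "(\<Sum>g\<in>?P. 1 / fact n * (\<Prod>m<len g. E g m)) = (\<Sum>g\<in>?P. \<Prod>m<len g. E g m) / fact n"
    by (simp add: sum_divide_distrib)
  ultimately show ?thesis
    by (simp add: h_def cong: has_bochner_integral_cong)
qed

section \<open>Random class functions and infinite products\<close>

text \<open>The exponential formula at work: the average over the symmetric group of the product of the power sums
  \<open>\<Sum>i. c i * u i ^ l\<close> over the cycle lengths \<open>l\<close> is a Taylor coefficient of the infinite product.\<close>
lemma sum_cycle_type_eq_coeff:
  fixes c u :: "'i \<Rightarrow> complex"
  assumes "\<And>i. cmod (u i) \<le> 1" "(\<lambda>i. norm (c i * u i)) summable_on UNIV"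
  shows "(\<Sum>g | g permutes {1..n}. \<Prod>m<length (cycle_type n g). \<Sum>\<^sub>\<infinity>i. c i * u i ^ (cycle_type n g ! m)) / fact n =
     fps_nth (fps_expansion (\<lambda>t. infprod (\<lambda>i. (1 - u i * t) powr (- c i)) UNIV) 0) n"
proof -
  have "(\<Sum>g | g permutes {1..n}. \<Prod>m<length (cycle_type n g). \<Sum>\<^sub>\<infinity>i. c i * u i ^ (cycle_type n g ! m)) =
    (\<Sum>g | g permutes {1..n}. cycle_weight (\<lambda>l. \<Sum>\<^sub>\<infinity>i. c i * u i ^ l) g {1..n})"
    by (intro sum.cong refl prod_cycle_type) simp
  also have "\<dots> = fact (card {1..n}) *
      fps_nth (fps_expansion (\<lambda>t. infprod (\<lambda>i. (1 - u i * t) powr (- c i)) UNIV) 0) (card {1..n})"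
    by (intro sum_cycle_weight infprod_product_coeff assms) simp
  finally show ?thesis by simp
qed

text \<open>Both random class functions are instances. A cycle of length \<open>l\<close> uses a block of \<open>s l\<close> pairs: \<open>s l = 1\<close> if there is
  one pair per cycle and \<open>s l = l\<close> if there is one per point. The last hypothesis says that the expectation of the factor of
  such a cycle is the \<open>l\<close>-th power sum of the family \<open>u\<close> with weights \<open>c\<close>; the moment thus enters \<open>c\<close> in the
  first case and \<open>u\<close> in the second.\<close>
lemma has_bochner_integral_random_class_function:
  fixes c u :: "nat \<times> nat \<Rightarrow> complex" and s :: "nat \<Rightarrow> nat"
  assumes U: "uniform_perm_with_iid L n I N G \<Theta>" and I: "finite I"
    and J: "\<And>g m. g permutes {1..n} \<Longrightarrow> m < length (cycle_type n g) \<Longrightarrow> J g m \<subseteq> I"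
    and disj: "\<And>g. g permutes {1..n} \<Longrightarrow> disjoint_family_on (J g) {..<length (cycle_type n g)}"
    and card: "\<And>g m. g permutes {1..n} \<Longrightarrow> m < length (cycle_type n g) \<Longrightarrow> card (J g m) = s (cycle_type n g ! m)"
    and f: "\<And>l u v. 0 < l \<Longrightarrow> u \<in> sphere 0 1 \<Longrightarrow> v \<in> sphere 0 1 \<Longrightarrow>
       ((\<lambda>(k1, k2). b k1 k2 * (x1 ^ l * u) ^ k1 * (x2 ^ l * v) ^ k2) has_sum f (x1 ^ l * u) (x2 ^ l * v)) UNIV"
    and u: "\<And>k. cmod (u k) \<le> 1" "(\<lambda>k. norm (c k * u k)) summable_on UNIV"
    and match: "\<And>k1 k2 l. 0 < l \<Longrightarrow>
       b k1 k2 * (x1 ^ l) ^ k1 * (x2 ^ l) ^ k2 * circle_moment L k1 k2 ^ s l = c (k1, k2) * u (k1, k2) ^ l"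
  shows "has_bochner_integral N
     (\<lambda>\<omega>. \<Prod>m<length (cycle_type n (G \<omega>)).
        f (x1 ^ (cycle_type n (G \<omega>) ! m) * (\<Prod>i\<in>J (G \<omega>) m. fst (\<Theta> i \<omega>)))
          (x2 ^ (cycle_type n (G \<omega>) ! m) * (\<Prod>i\<in>J (G \<omega>) m. snd (\<Theta> i \<omega>))))
     (fps_nth (fps_expansion (\<lambda>t. infprod (\<lambda>k. (1 - u k * t) powr (- c k)) UNIV) 0) n)"
proof -
  have ser: "((\<lambda>(k1, k2). b k1 k2 * (x1 ^ l) ^ k1 * (x2 ^ l) ^ k2 * u ^ k1 * v ^ k2) has_sum
      f (x1 ^ l * u) (x2 ^ l * v)) UNIV" if "0 < l" "u \<in> sphere 0 1" "v \<in> sphere 0 1" for l u v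
    using f[OF that] by (simp add: power_mult_distrib mult_ac)
  have iid: "prob_space N" "prob_space.indep_vars N (\<lambda>_. circle_pairs) \<Theta> I"
      "\<And>i. i \<in> I \<Longrightarrow> distr N circle_pairs (\<Theta> i) = L"
    using U by (auto simp: uniform_perm_with_iid_def)
  have "has_bochner_integral N
     (\<lambda>\<omega>. \<Prod>m<length (cycle_type n (G \<omega>)).
        f (x1 ^ (cycle_type n (G \<omega>) ! m) * (\<Prod>i\<in>J (G \<omega>) m. fst (\<Theta> i \<omega>)))
          (x2 ^ (cycle_type n (G \<omega>) ! m) * (\<Prod>i\<in>J (G \<omega>) m. snd (\<Theta> i \<omega>))))
     ((\<Sum>g | g permutes {1..n}. \<Prod>m<length (cycle_type n g). \<Sum>\<^sub>\<infinity>k. c k * u k ^ (cycle_type n g ! m)) / fact n)"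
  proof (rule uniform_perm_with_iid_expectation[OF U I J disj, where
      H = "\<lambda>g m p q. f (x1 ^ (cycle_type n g ! m) * p) (x2 ^ (cycle_type n g ! m) * q)"])
    fix g m assume g: "g permutes {1..n}" "m < length (cycle_type n g)"
    define l where "l = cycle_type n g ! m"
    have l: "0 < l" using cycle_type_nth_bounds[OF g] by (simp add: l_def)
    show "(\<lambda>z. f (x1 ^ (cycle_type n g ! m) * (\<Prod>i\<in>J g m. fst (z i)))
                 (x2 ^ (cycle_type n g ! m) * (\<Prod>i\<in>J g m. snd (z i))))
        \<in> borel_measurable (PiM (J g m) (\<lambda>_. circle_pairs))"
      unfolding l_def[symmetric] by (rule circle_series_prod_measurable[OF ser[OF l]])
    have "has_bochner_integral N (\<lambda>\<omega>. f (x1 ^ l * (\<Prod>i\<in>J g m. fst (\<Theta> i \<omega>))) (x2 ^ l * (\<Prod>i\<in>J g m. snd (\<Theta> i \<omega>))))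
       (\<Sum>\<^sub>\<infinity>(k1, k2). b k1 k2 * (x1 ^ l) ^ k1 * (x2 ^ l) ^ k2 * circle_moment L k1 k2 ^ card (J g m))"
      using J[OF g] I iid
      by (intro has_bochner_integral_circle_series[OF ser[OF l]])
         (auto intro: finite_subset prob_space.indep_vars_subset)
    also have "(\<lambda>(k1, k2). b k1 k2 * (x1 ^ l) ^ k1 * (x2 ^ l) ^ k2 * circle_moment L k1 k2 ^ card (J g m)) =
        (\<lambda>k. c k * u k ^ l)"
      using match[OF l] card[OF g] by (auto simp: l_def)
    finally show "has_bochner_integral N
        (\<lambda>\<omega>. f (x1 ^ (cycle_type n g ! m) * (\<Prod>i\<in>J g m. fst (\<Theta> i \<omega>)))
               (x2 ^ (cycle_type n g ! m) * (\<Prod>i\<in>J g m. snd (\<Theta> i \<omega>))))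
        (\<Sum>\<^sub>\<infinity>k. c k * u k ^ (cycle_type n g ! m))"
      by (simp add: l_def)
  qed
  then show ?thesis unfolding sum_cycle_type_eq_coeff[OF u] .
qed

lemma Omega'_D:
  assumes "(x1, x2) \<in> Omega' r1 r2"
  shows "cmod x1 < r1" "cmod x2 < r2" "cmod x1 \<le> 1" "cmod x2 \<le> 1"
  using assms by (auto simp: Omega'_def)

text \<open>Being holomorphic is local, so it is enough to work on a small ball inside the set, where the moduli of the first two
  coordinates stay below radii smaller than \<open>r1\<close> and \<open>r2\<close> and that of the third stays below a number smaller than \<open>1\<close>.\<close>
lemma monomial_infprod_holomorphic_several:
  fixes c \<beta> :: "nat \<times> nat \<Rightarrow> complex"
  assumes \<beta>: "\<And>k. cmod (\<beta> k) \<le> 1"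
    and summ: "\<And>s1 s2. 0 \<le> s1 \<Longrightarrow> s1 < r1 \<Longrightarrow> 0 \<le> s2 \<Longrightarrow> s2 < r2 \<Longrightarrow>
       (\<lambda>(k1, k2). cmod (c (k1, k2)) * s1 ^ k1 * s2 ^ k2) summable_on UNIV"
  shows "holomorphic_several
     (\<lambda>z::complex^3. infprod (\<lambda>k. (1 - (\<beta> k * (z $ 1) ^ fst k * (z $ 2) ^ snd k) * (z $ 3)) powr (- c k)) UNIV)
     (interior {z. (z $ 1, z $ 2) \<in> Omega' r1 r2 \<and> z $ 3 \<in> ball 0 1})" (is "holomorphic_several ?P (interior ?A)")
proof (rule holomorphic_several_locally)
  fix z0 :: "complex ^ 3" assume "z0 \<in> interior ?A"
  then obtain \<epsilon> where \<epsilon>: "\<epsilon> > 0" "ball z0 \<epsilon> \<subseteq> ?A" by (auto simp: mem_interior)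
  moreover have "z0 \<in> ball z0 \<epsilon>" using \<epsilon>(1) by simp
  ultimately have "z0 \<in> ?A" by blast
  then have z0: "cmod (z0 $ 1) < r1" "cmod (z0 $ 2) < r2" "cmod (z0 $ 3) < 1"
    using Omega'_D[of "z0 $ 1" "z0 $ 2"] by auto
  obtain \<rho>1 \<sigma>1 where 1: "cmod (z0 $ 1) < \<rho>1" "\<rho>1 < \<sigma>1" "\<sigma>1 < r1" using z0(1) dense by metis
  obtain \<rho>2 \<sigma>2 where 2: "cmod (z0 $ 2) < \<rho>2" "\<rho>2 < \<sigma>2" "\<sigma>2 < r2" using z0(2) dense by metis
  obtain \<rho>3 where 3: "cmod (z0 $ 3) < \<rho>3" "\<rho>3 < 1" using z0(3) dense by metis
  have \<rho>: "0 \<le> \<rho>1" "\<rho>1 < \<sigma>1" "0 \<le> \<rho>2" "\<rho>2 < \<sigma>2" "\<rho>3 < 1" "0 \<le> \<sigma>1" "\<sigma>1 < r1" "0 \<le> \<sigma>2" "\<sigma>2 < r2"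
    using 1 2 3 norm_ge_zero[of "z0 $ 1"] norm_ge_zero[of "z0 $ 2"] by linarith+
  define \<delta> where "\<delta> = min \<epsilon> (min (\<rho>1 - cmod (z0 $ 1)) (min (\<rho>2 - cmod (z0 $ 2)) (\<rho>3 - cmod (z0 $ 3))))"
  have \<delta>: "\<delta> > 0" "\<delta> \<le> \<epsilon>" "cmod (z0 $ 1) + \<delta> \<le> \<rho>1" "cmod (z0 $ 2) + \<delta> \<le> \<rho>2" "cmod (z0 $ 3) + \<delta> \<le> \<rho>3"
    using \<epsilon>(1) 1 2 3 by (simp_all add: \<delta>_def)
  have bd: "cmod (z $ i) < cmod (z0 $ i) + \<delta>" if "z \<in> ball z0 \<delta>" for z i
    using that dist_vec_nth_le[of z i z0] norm_triangle_sub[of "z $ i" "z0 $ i"]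
    by (simp add: dist_norm norm_minus_commute)
  let ?u = "\<lambda>z k. \<beta> k * (z $ 1) ^ fst k * (z $ 2) ^ snd k"
  have inA: "z \<in> ?A" if "z \<in> ball z0 \<delta>" for z
    using that subset_ball[OF \<delta>(2), of z0] \<epsilon>(2) by blast
  have u_le: "cmod (?u z k) \<le> 1" if "z \<in> ball z0 \<delta>" for z k
  proof -
    have "cmod (z $ 1) \<le> 1" "cmod (z $ 2) \<le> 1"
      using inA[OF that] Omega'_D[of "z $ 1" "z $ 2"] by auto
    then have "cmod (\<beta> k) * cmod (z $ 1) ^ fst k * cmod (z $ 2) ^ snd k \<le> 1 * 1 * 1"
      using \<beta> by (intro mult_mono power_le_one) auto
    then show ?thesis by (simp add: norm_mult norm_power)
  qed
  have sm: "(\<lambda>k. norm (c k * ?u z k)) summable_on UNIV" if "z \<in> ball z0 \<delta>" for z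
  proof (rule summable_on_comparison_test)
    show "(\<lambda>k. cmod (c k) * \<sigma>1 ^ fst k * \<sigma>2 ^ snd k) summable_on UNIV"
      using summ[OF \<rho>(6-9)] by (simp add: case_prod_unfold)
    have "cmod (z $ 1) \<le> \<sigma>1" "cmod (z $ 2) \<le> \<sigma>2"
      using bd[OF that, of 1] bd[OF that, of 2] \<delta> \<rho> by linarith+
    then have "cmod (c k) * (cmod (\<beta> k) * cmod (z $ 1) ^ fst k * cmod (z $ 2) ^ snd k) \<le>
       cmod (c k) * (1 * \<sigma>1 ^ fst k * \<sigma>2 ^ snd k)" for k
      using \<beta> \<rho> by (intro mult_mono mult_left_mono power_mono) auto
    then show "norm (c k * ?u z k) \<le> cmod (c k) * \<sigma>1 ^ fst k * \<sigma>2 ^ snd k" for k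
      by (simp add: norm_mult norm_power mult_ac)
  qed auto
  have t: "cmod (z $ 3) < 1" if "z \<in> ball z0 \<delta>" for z using inA[OF that] by simp
  have "holomorphic_several (\<lambda>z. \<Sum>\<^sub>\<infinity>k. - c k * Ln (1 - ?u z k * z $ 3)) (ball z0 \<delta>)"
  proof (rule log_series_holomorphic_several[where c = c and \<beta> = \<beta>, OF convex_ball open_ball \<rho>(1-5) \<beta> summ[OF \<rho>(6-9)]])
    fix z assume z: "z \<in> ball z0 \<delta>"
    show "cmod (z $ 1) \<le> \<rho>1" "cmod (z $ 2) \<le> \<rho>2" "cmod (z $ 3) \<le> \<rho>3"
      using bd[OF z, of 1] bd[OF z, of 2] bd[OF z, of 3] \<delta> by linarith+
    show "cmod (z $ 1) \<le> 1" "cmod (z $ 2) \<le> 1"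
      using inA[OF z] Omega'_D[of "z $ 1" "z $ 2"] by auto
    show "((\<lambda>(k1, k2). - c (k1, k2) * Ln (1 - \<beta> (k1, k2) * (z $ 1) ^ k1 * (z $ 2) ^ k2 * (z $ 3))) has_sum
        (\<Sum>\<^sub>\<infinity>k. - c k * Ln (1 - ?u z k * z $ 3))) UNIV"
      using log_product_has_sum(1)[OF u_le[OF z] sm[OF z] t[OF z]] by (simp add: case_prod_unfold)
  qed
  then have "holomorphic_several (\<lambda>z. exp (\<Sum>\<^sub>\<infinity>k. - c k * Ln (1 - ?u z k * z $ 3))) (ball z0 \<delta>)"
    by (rule holomorphic_several_exp)
  then have "holomorphic_several ?P (ball z0 \<delta>)"
    by (rule holomorphic_several_transform) (use infprod_product[OF u_le sm t] in auto)
  then show "\<exists>T. z0 \<in> T \<and> holomorphic_several ?P T" using \<delta>(1) by (intro exI[of _ "ball z0 \<delta>"]) auto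
qed

theorem theorem5p2:
  fixes r1 r2 :: real
    and f :: "complex \<Rightarrow> complex \<Rightarrow> complex"
    and b :: "nat \<Rightarrow> nat \<Rightarrow> complex"
    and M :: "'a measure"
    and \<theta> \<phi> :: "'a \<Rightarrow> complex"
    and \<alpha> :: "nat \<Rightarrow> nat \<Rightarrow> complex"
    and L :: "(complex \<times> complex) measure"
    and P1 P2 :: "complex \<Rightarrow> complex \<Rightarrow> complex \<Rightarrow> complex"
  assumes r_pos: "r1 > 0" "r2 > 0"
    and f_hol: "holomorphic_several (\<lambda>z::complex^2. f (z $ 1) (z $ 2))
                  {z. z $ 1 \<in> ball 0 r1 \<and> z $ 2 \<in> ball 0 r2}"
    and f_series: "\<And>x1 x2. x1 \<in> ball 0 r1 \<Longrightarrow> x2 \<in> ball 0 r2 \<Longrightarrow>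
                  ((\<lambda>(k1, k2). b k1 k2 * x1 ^ k1 * x2 ^ k2) has_sum f x1 x2) UNIV"
    and M: "prob_space M"
    and rv: "\<theta> \<in> borel_measurable M" "\<phi> \<in> borel_measurable M"
    and circle: "\<And>\<omega>. \<omega> \<in> space M \<Longrightarrow> \<theta> \<omega> \<in> sphere 0 1"
                "\<And>\<omega>. \<omega> \<in> space M \<Longrightarrow> \<phi> \<omega> \<in> sphere 0 1"
  defines "\<alpha> \<equiv> (\<lambda>k1 k2. prob_space.expectation M (\<lambda>\<omega>. \<theta> \<omega> ^ k1 * \<phi> \<omega> ^ k2))"
    and "L \<equiv> distr M circle_pairs (\<lambda>\<omega>. (\<theta> \<omega>, \<phi> \<omega>))"
    and "P1 \<equiv> (\<lambda>x1 x2 t. infprod (factor1 \<alpha> b x1 x2 t) UNIV)"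
    and "P2 \<equiv> (\<lambda>x1 x2 t. infprod (factor2 \<alpha> b x1 x2 t) UNIV)"
  shows
    "(\<forall>(x1, x2)\<in>Omega' r1 r2. \<forall>t\<in>ball 0 1.
        infprod_convergent (factor1 \<alpha> b x1 x2 t) UNIV \<and>
        infprod_convergent (factor2 \<alpha> b x1 x2 t) UNIV) \<and>
     (\<forall>(x1, x2)\<in>Omega' r1 r2. \<forall>n.
        (\<forall>(N :: 'v measure) G \<Theta>. uniform_perm_with_iid L n {..<n} N G \<Theta> \<longrightarrow>
           has_bochner_integral N (\<lambda>\<omega>. W1 f x1 x2 n (\<lambda>m. \<Theta> m \<omega>) (G \<omega>))
             (fps_nth (fps_expansion (P1 x1 x2) 0) n)) \<and>
        (\<forall>(N :: 'w measure) G \<Theta>. uniform_perm_with_iid L n ({..<n} \<times> {..<n}) N G \<Theta> \<longrightarrow>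
           has_bochner_integral N (\<lambda>\<omega>. W2 f x1 x2 n (\<lambda>mi. \<Theta> mi \<omega>) (G \<omega>))
             (fps_nth (fps_expansion (P2 x1 x2) 0) n))) \<and>
     holomorphic_several (\<lambda>z::complex^3. P1 (z $ 1) (z $ 2) (z $ 3))
       (interior {z. (z $ 1, z $ 2) \<in> Omega' r1 r2 \<and> z $ 3 \<in> ball 0 1}) \<and>
     holomorphic_several (\<lambda>z::complex^3. P2 (z $ 1) (z $ 2) (z $ 3))
       (interior {z. (z $ 1, z $ 2) \<in> Omega' r1 r2 \<and> z $ 3 \<in> ball 0 1}) \<and>
     (\<forall>(x1, x2)\<in>Omega' r1 r2.
        (\<lambda>t. P1 x1 x2 t) holomorphic_on ball 0 1 \<and>
        (\<lambda>t. P2 x1 x2 t) holomorphic_on ball 0 1)"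
proof -
  let ?c1 = "\<lambda>k. \<alpha> (fst k) (snd k) * b (fst k) (snd k)" and ?c2 = "\<lambda>k. b (fst k) (snd k)"
  let ?u1 = "\<lambda>x1 x2 k. x1 ^ fst k * x2 ^ snd k :: complex"
  let ?u2 = "\<lambda>x1 x2 k. \<alpha> (fst k) (snd k) * x1 ^ fst k * x2 ^ snd k"
  interpret M: prob_space M by (rule M)
  have pair_meas: "(\<lambda>\<omega>. (\<theta> \<omega>, \<phi> \<omega>)) \<in> measurable M circle_pairs"
    by (rule measurable_into_circle_pairs) (use rv circle in auto)
  have \<alpha>_moment: "circle_moment L k1 k2 = \<alpha> k1 k2" for k1 k2
    unfolding circle_moment_def L_def \<alpha>_def
    by (subst integral_distr[OF pair_meas])
       (auto intro!: borel_measurable_times borel_measurable_power fst_circle_pairs_measurable snd_circle_pairs_measurable)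
  have \<alpha>_le: "cmod (\<alpha> k1 k2) \<le> 1" for k1 k2
  proof -
    have "cmod (\<alpha> k1 k2) \<le> (\<integral>\<omega>. cmod (\<theta> \<omega> ^ k1 * \<phi> \<omega> ^ k2) \<partial>M)"
      unfolding \<alpha>_def by (rule integral_norm_bound)
    also have "\<dots> = (\<integral>\<omega>. 1 \<partial>M)"
      using circle by (intro Bochner_Integration.integral_cong) (auto simp: norm_mult norm_power)
    finally show ?thesis by (simp add: M.prob_space)
  qed
  have b_summ: "(\<lambda>(k1, k2). cmod (b k1 k2) * s1 ^ k1 * s2 ^ k2) summable_on UNIV"
    if "0 \<le> s1" "s1 < r1" "0 \<le> s2" "s2 < r2" for s1 s2
  proof -
    have "(\<lambda>(k1, k2). b k1 k2 * of_real s1 ^ k1 * of_real s2 ^ k2) summable_on UNIV"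
      using f_series[of "of_real s1" "of_real s2"] that by (auto simp: summable_on_def)
    then show ?thesis
      using that by (subst (asm) summable_on_iff_abs_summable_on_complex)
        (simp add: case_prod_unfold norm_mult norm_power)
  qed
  have c1_summ: "(\<lambda>(k1, k2). cmod (?c1 (k1, k2)) * s1 ^ k1 * s2 ^ k2) summable_on UNIV"
    if "0 \<le> s1" "s1 < r1" "0 \<le> s2" "s2 < r2" for s1 s2
  proof (rule summable_on_comparison_test[OF b_summ[OF that]])
    show "(case k of (k1, k2) \<Rightarrow> cmod (?c1 (k1, k2)) * s1 ^ k1 * s2 ^ k2) \<le>
       (case k of (k1, k2) \<Rightarrow> cmod (b k1 k2) * s1 ^ k1 * s2 ^ k2)" for k
      using \<alpha>_le that by (auto simp: norm_mult case_prod_unfold intro!: mult_right_mono mult_left_le_one_le)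
  qed (use that in auto)
  have eq1: "factor1 \<alpha> b x1 x2 t = (\<lambda>k. (1 - ?u1 x1 x2 k * t) powr (- ?c1 k))" for x1 x2 t
    by (auto simp: factor1_def)
  have eq2: "factor2 \<alpha> b x1 x2 t = (\<lambda>k. (1 - ?u2 x1 x2 k * t) powr (- ?c2 k))" for x1 x2 t
    by (auto simp: factor2_def)
  have u_le: "cmod (?u1 x1 x2 k) \<le> 1" "cmod (?u2 x1 x2 k) \<le> 1"
    if "(x1, x2) \<in> Omega' r1 r2" for x1 x2 k
  proof -
    have "cmod x1 ^ fst k * cmod x2 ^ snd k \<le> 1 * 1"
      using Omega'_D[OF that] by (intro mult_mono power_le_one) auto
    then show "cmod (?u1 x1 x2 k) \<le> 1" by (simp add: norm_mult norm_power)
    then have "cmod (\<alpha> (fst k) (snd k)) * cmod (?u1 x1 x2 k) \<le> 1 * 1"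
      using \<alpha>_le by (intro mult_mono) auto
    then show "cmod (?u2 x1 x2 k) \<le> 1" by (simp add: norm_mult mult_ac)
  qed
  have summ: "(\<lambda>k. norm (?c1 k * ?u1 x1 x2 k)) summable_on UNIV" "(\<lambda>k. norm (?c2 k * ?u2 x1 x2 k)) summable_on UNIV"
    if "(x1, x2) \<in> Omega' r1 r2" for x1 x2
    using c1_summ[of "cmod x1" "cmod x2"] Omega'_D[OF that]
    by (auto simp: case_prod_unfold norm_mult norm_power mult_ac)
  have P1: "P1 x1 x2 = (\<lambda>t. infprod (\<lambda>k. (1 - ?u1 x1 x2 k * t) powr (- ?c1 k)) UNIV)" for x1 x2
    unfolding P1_def eq1 ..
  have P2: "P2 x1 x2 = (\<lambda>t. infprod (\<lambda>k. (1 - ?u2 x1 x2 k * t) powr (- ?c2 k)) UNIV)" for x1 x2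
    unfolding P2_def eq2 ..
  have conv: "infprod_convergent (factor1 \<alpha> b x1 x2 t) UNIV \<and> infprod_convergent (factor2 \<alpha> b x1 x2 t) UNIV"
    if "(x1, x2) \<in> Omega' r1 r2" "t \<in> ball 0 1" for x1 x2 t
    unfolding eq1 eq2 infprod_convergent_def
    using product_has_infprod[OF u_le(1)[OF that(1)] summ(1)[OF that(1)], of t]
      product_has_infprod[OF u_le(2)[OF that(1)] summ(2)[OF that(1)], of t] that(2) by auto
  have ser: "((\<lambda>(k1, k2). b k1 k2 * (x1 ^ l * u) ^ k1 * (x2 ^ l * v) ^ k2) has_sum f (x1 ^ l * u) (x2 ^ l * v)) UNIV"
    if "(x1, x2) \<in> Omega' r1 r2" "0 < l" "u \<in> sphere 0 1" "v \<in> sphere 0 1" for x1 x2 u v and l :: nat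
  proof (rule f_series)
    note x = Omega'_D[OF that(1)]
    \<comment> \<open>Raising to the power \<open>l\<close> does not leave the domain of \<open>f\<close>, since \<open>cmod x1\<close> and \<open>cmod x2\<close> are at most \<open>1\<close>.\<close>
    have "cmod x1 ^ l \<le> cmod x1 ^ 1" "cmod x2 ^ l \<le> cmod x2 ^ 1"
      using x that(2) by (intro power_decreasing; simp)+
    with x that show "x1 ^ l * u \<in> ball 0 r1" "x2 ^ l * v \<in> ball 0 r2"
      by (auto simp: norm_mult norm_power)
  qed
  have W1: "has_bochner_integral N (\<lambda>\<omega>. W1 f x1 x2 n (\<lambda>m. \<Theta> m \<omega>) (G \<omega>)) (fps_nth (fps_expansion (P1 x1 x2) 0) n)"
    if x: "(x1, x2) \<in> Omega' r1 r2" and U: "uniform_perm_with_iid L n {..<n} N G \<Theta>"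
    for x1 x2 n and N :: "'v measure" and G \<Theta>
  proof -
    have "has_bochner_integral N
       (\<lambda>\<omega>. \<Prod>m<length (cycle_type n (G \<omega>)).
          f (x1 ^ (cycle_type n (G \<omega>) ! m) * (\<Prod>i\<in>{m}. fst (\<Theta> i \<omega>)))
            (x2 ^ (cycle_type n (G \<omega>) ! m) * (\<Prod>i\<in>{m}. snd (\<Theta> i \<omega>))))
       (fps_nth (fps_expansion (P1 x1 x2) 0) n)"
      unfolding P1
    proof (rule has_bochner_integral_random_class_function[OF U, where J = "\<lambda>g m. {m}" and s = "\<lambda>l. 1" and b = b])
      show "{m} \<subseteq> {..<n}" if "m < length (cycle_type n g)" for g m
        using that length_cycle_type_le[of n g] by auto
      show "disjoint_family_on (\<lambda>m. {m}) {..<length (cycle_type n g)}" for g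
        by (auto simp: disjoint_family_on_def)
      show "b k1 k2 * (x1 ^ l) ^ k1 * (x2 ^ l) ^ k2 * circle_moment L k1 k2 ^ 1 =
        ?c1 (k1, k2) * ?u1 x1 x2 (k1, k2) ^ l" for k1 k2 l
        by (simp add: \<alpha>_moment power_mult_distrib mult_ac flip: power_mult)
    qed (use ser[OF x] u_le(1)[OF x] summ(1)[OF x] in auto)
    then show ?thesis by (simp add: W1_def Let_def mult.commute)
  qed
  have W2: "has_bochner_integral N (\<lambda>\<omega>. W2 f x1 x2 n (\<lambda>mi. \<Theta> mi \<omega>) (G \<omega>)) (fps_nth (fps_expansion (P2 x1 x2) 0) n)"
    if x: "(x1, x2) \<in> Omega' r1 r2" and U: "uniform_perm_with_iid L n ({..<n} \<times> {..<n}) N G \<Theta>"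
    for x1 x2 n and N :: "'w measure" and G \<Theta>
  proof -
    have "has_bochner_integral N
       (\<lambda>\<omega>. \<Prod>m<length (cycle_type n (G \<omega>)).
          f (x1 ^ (cycle_type n (G \<omega>) ! m) * (\<Prod>i\<in>Pair m ` {..<cycle_type n (G \<omega>) ! m}. fst (\<Theta> i \<omega>)))
            (x2 ^ (cycle_type n (G \<omega>) ! m) * (\<Prod>i\<in>Pair m ` {..<cycle_type n (G \<omega>) ! m}. snd (\<Theta> i \<omega>))))
       (fps_nth (fps_expansion (P2 x1 x2) 0) n)"
      unfolding P2
    proof (rule has_bochner_integral_random_class_function[OF U, where
        J = "\<lambda>g m. Pair m ` {..<cycle_type n g ! m}" and s = "\<lambda>l. l" and b = b])
      show "Pair m ` {..<cycle_type n g ! m} \<subseteq> {..<n} \<times> {..<n}"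
        if "g permutes {1..n}" "m < length (cycle_type n g)" for g m
        using that length_cycle_type_le[of n g] cycle_type_nth_bounds(2)[OF that] by auto
      show "disjoint_family_on (\<lambda>m. Pair m ` {..<cycle_type n g ! m}) {..<length (cycle_type n g)}" for g
        by (auto simp: disjoint_family_on_def)
      show "card (Pair m ` {..<cycle_type n g ! m}) = cycle_type n g ! m" for g m
        by (simp add: card_image inj_on_def)
      show "b k1 k2 * (x1 ^ l) ^ k1 * (x2 ^ l) ^ k2 * circle_moment L k1 k2 ^ l =
        ?c2 (k1, k2) * ?u2 x1 x2 (k1, k2) ^ l" for k1 k2 l
        by (simp add: \<alpha>_moment power_mult_distrib mult_ac flip: power_mult)
    qed (use ser[OF x] u_le(2)[OF x] summ(2)[OF x] in auto)
    then show ?thesis by (simp add: W2_def Let_def prod.reindex inj_on_def)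
  qed
  have "holomorphic_several (\<lambda>z::complex^3. P1 (z $ 1) (z $ 2) (z $ 3))
       (interior {z. (z $ 1, z $ 2) \<in> Omega' r1 r2 \<and> z $ 3 \<in> ball 0 1})"
    using monomial_infprod_holomorphic_several[of "\<lambda>_. 1" r1 r2 ?c1] c1_summ by (simp add: P1)
  moreover have "holomorphic_several (\<lambda>z::complex^3. P2 (z $ 1) (z $ 2) (z $ 3))
       (interior {z. (z $ 1, z $ 2) \<in> Omega' r1 r2 \<and> z $ 3 \<in> ball 0 1})"
    using monomial_infprod_holomorphic_several[of "\<lambda>k. \<alpha> (fst k) (snd k)" r1 r2 ?c2] b_summ \<alpha>_le by (simp add: P2)
  moreover have "(\<lambda>t. P1 x1 x2 t) holomorphic_on ball 0 1 \<and> (\<lambda>t. P2 x1 x2 t) holomorphic_on ball 0 1"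
    if "(x1, x2) \<in> Omega' r1 r2" for x1 x2
    unfolding P1 P2 using u_le[OF that] summ[OF that] by (intro conjI infprod_product_holomorphic) 
  ultimately show ?thesis using conv W1 W2 by blast
qed

end
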